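(* Let $S_r$ be a reference set of size $N$ with expansion constant $c_r$ and let $S_q$ be a query set of size $O(N)$, with cover trees $\mathscr{T}_r$ and $\mathscr{T}_q$ built on them. Let $c_{qr}=\max\bigl(\max_{p_q\in S_q} c'_r(p_q),\ c_r\bigr)$, where $c'_r(p_q)$ is the expansion constant of $S_r\cup\{p_q\}$. Using the standard cover tree pruning dual-tree traversal with the nearest neighbor search functions BaseCase and Score (all described in the context), the running time of the nearest neighbor search algorithm is bounded by $$O\left(c_r^4\, c_{qr}^5\, \bigl(N + i_t(\mathscr{T}_q) + \theta\bigr)\right),$$ where $i_t(\mathscr{T}_q)$ is the cover tree imbalance of the query tree and $\theta = \max\{\min[O(N\log_2(\delta_q/\delta_r)), O(N^2)],\, 0\}$, with $\delta_q$ and $\delta_r$ the smallest nonzero pairwise distances in $S_q$ and $S_r$ respectively.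
   Context: All data sets are finite subsets of a metric space with metric $d$. Running times do not include the construction of the trees. **Expansion constant.** For $p\in S$ let $B_S(p,\Delta)=\{r\in S: d(p,r)\le\Delta\}$. The expansion constant of $S$ is the smallest $c\ge 2$ such that $|B_S(p,2\Delta)|\le c\,|B_S(p,\Delta)|$ for all $p\in S$ and all $\Delta>0$. **Cover tree.** A cover tree on $S$ is a leveled tree whose levels are indexed by integer scales $s$ that decrease as the tree is descended. Every node is associated with a point of $S$, and a point appears at most once in every level. With $C_s$ the set of points associated with nodes at level $s$, for all $s$: (Nesting) $C_s\subset C_{s-1}$; (Covering) for every $p\in C_{s-1}$ there is $p'\in C_s$ with $d(p,p')<2^{s}$ such that the node of $p'$ at level $s$ is the parent of the node of $p$ at level $s-1$; (Separation) $d(p,p')>2^s$ for all distinct $p,p'\in C_s$. Conceptually (implicit representation) the tree has infinitely many levels, $C_\infty$ consisting of the root point only and $C_{-\infty}=S$. Throughout, the explicit representation is used: every node whose only child is its self-child (the child associated with the same point) is coalesced with it (the self-child is removed and its children become the children of the node). Leaves have scale $-\infty$, and $2^{-\infty}=0$. For a node $\mathscr{N}_i$, $p_i$ is its point, $s_i$ its scale, $\mathscr{C}(\mathscr{N}_i)$ its set of children; every descendant point of $\mathscr{N}_i$ is within distance $2^{s_i+1}$ of $p_i$. The smallest scale of a non-leaf node in a cover tree on $S$ is $\lceil\log_2\delta\rceil$, where $\delta$ is the smallest nonzero pairwise distance in $S$. **Imbalance.** For a node $\mathscr{N}_i$ of a cover tree $\mathscr{T}$ with parent of scale $s_p$, and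 $s_{\min}$ the smallest scale of a non-leaf node of $\mathscr{T}$, the node imbalance $i_n(\mathscr{N}_i)$ is $0$ if $\mathscr{N}_i$ is the root, $\max(s_p-s_{\min}-1,0)$ if $\mathscr{N}_i$ is a leaf, and $s_p-s_i-1$ otherwise. The cover tree imbalance is $i_t(\mathscr{T})=\sum_{\mathscr{N}_i\in\mathscr{T}} i_n(\mathscr{N}_i)$. **Standard pruning dual-tree traversal.** A problem is specified by a point-to-point function BaseCase$(p_q,p_r)$ and a node-to-node function Score$(\mathscr{N}_q,\mathscr{N}_r)$, which returns $\infty$ exactly when the node pair is to be pruned. The recursive traversal takes a query node $\mathscr{N}_q$ and a set $R$ of reference nodes, and is first called with the root of $\mathscr{T}_q$ and $R=\{\text{root of }\mathscr{T}_r\}$. In a call $(\mathscr{N}_q,R)$, put $s_r^{\max}=\max_{\mathscr{N}_r\in R}s_r$. - If $s_q<s_r^{\max}$ (reference recursion): call BaseCase$(p_q,p_r)$ for every $\mathscr{N}_r\in R$; let $R_r=\{\mathscr{N}_r\in R: s_r=s_r^{\max}\}$; let $R_{r-1}$ be the set of all children of nodes of $R_r$ together with $R\setminus R_r$; let $R'_{r-1}=\{\mathscr{N}_r\in R_{r-1}:\text{Score}(\mathscr{N}_q,\mathscr{N}_r)\ne\infty\}$; recurse with $(\mathscr{N}_q,R'_{r-1})$. - Otherwise (query recursion): for every child $\mathscr{N}_{qc}$ of $\mathscr{N}_q$, let $R'=\{\mathscr{N}_r\in R:\text{Score}(\mathscr{N}_{qc},\mathscr{N}_r)\ne\infty\}$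 and recurse with $(\mathscr{N}_{qc},R')$. **Nearest neighbor search.** The task is to find, for each $p_q\in S_q$, a nearest point of $S_r$. The algorithm stores for each $p_q$ a candidate neighbor $N[p_q]$ and its distance $D[p_q]$ (initially $\infty$). BaseCase$(p_q,p_r)$: if $d(p_q,p_r)<D[p_q]$ and BaseCase$(p_q,p_r)$ has not yet been called, set $D[p_q]\gets d(p_q,p_r)$ and $N[p_q]\gets p_r$; return $d(p_q,p_r)$. Score$(\mathscr{N}_q,\mathscr{N}_r)$: if $d_{\min}(\mathscr{N}_q,\mathscr{N}_r)<B(\mathscr{N}_q)$ return $d_{\min}(\mathscr{N}_q,\mathscr{N}_r)$, otherwise return $\infty$. Here $d_{\min}(\mathscr{N}_q,\mathscr{N}_r)=d(p_q,p_r)-2^{s_q+1}-2^{s_r+1}$ and $B(\mathscr{N}_q)=D[p_q]+2^{s_q+1}$. *)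

theory Defs
  imports "HOL-Analysis.Analysis"
begin

definition set_ball :: "('a \<Rightarrow> 'a \<Rightarrow> real) \<Rightarrow> 'a set \<Rightarrow> 'a \<Rightarrow> real \<Rightarrow> 'a set" where
  "set_ball d S p \<Delta> = {r \<in> S. d p r \<le> \<Delta>}"

definition expansion_constant :: "('a \<Rightarrow> 'a \<Rightarrow> real) \<Rightarrow> 'a set \<Rightarrow> real" where
  "expansion_constant d S =
     (LEAST c::real. 2 \<le> c \<and>
        (\<forall>p\<in>S. \<forall>\<Delta>>0. real (card (set_ball d S p (2 * \<Delta>))) \<le> c * real (card (set_ball d S p \<Delta>))))"

text \<open>Unspecified (\<open>Min {}\<close>) if \<open>S\<close> has fewer than two points. This only affects \<open>theta\<close> below,
  which is nonnegative in any case.\<close>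

definition min_nonzero_dist :: "('a \<Rightarrow> 'a \<Rightarrow> real) \<Rightarrow> 'a set \<Rightarrow> real" where
  "min_nonzero_dist d S = Min {d x y | x y. x \<in> S \<and> y \<in> S \<and> d x y \<noteq> 0}"

text \<open>
  The implicit representation: \<open>C s\<close> is the set of points at level \<open>s\<close>, and \<open>par s p\<close> is the
  point of the level \<open>s\<close> parent of the level \<open>s - 1\<close> node of \<open>p\<close>. Since the levels are nested,
  the levels at \<open>-\<infinity>\<close> and \<open>\<infinity>\<close> are the union and the intersection of all levels. That \<open>p\<close>
  is its own parent whenever it occurs in two adjacent levels follows from covering and separation.
\<close>

definition implicit_cover_tree ::
    "('a \<Rightarrow> 'a \<Rightarrow> real) \<Rightarrow> 'a set \<Rightarrow> (int \<Rightarrow> 'a set) \<Rightarrow> (int \<Rightarrow> 'a \<Rightarrow> 'a) \<Rightarrow> 'a \<Rightarrow> bool" where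
  "implicit_cover_tree d S C par r \<longleftrightarrow>
     (\<forall>s. C s \<subseteq> C (s - 1)) \<and>
     (\<forall>s. \<forall>p\<in>C (s - 1). par s p \<in> C s \<and> d p (par s p) < 2 powi s) \<and>
     (\<forall>s. \<forall>p\<in>C s. \<forall>p'\<in>C s. p \<noteq> p' \<longrightarrow> d p p' > 2 powi s) \<and>
     (\<Union>s. C s) = S \<and>
     (\<Inter>s. C s) = {r}"

definition implicit_children :: "(int \<Rightarrow> 'a set) \<Rightarrow> (int \<Rightarrow> 'a \<Rightarrow> 'a) \<Rightarrow> int \<Rightarrow> 'a \<Rightarrow> 'a set" where
  "implicit_children C par s p = {x \<in> C (s - 1). par s x = p}"

text \<open>
  Explicit trees; the subtrees of a tree are its nodes. A node \<open>Node p s ts\<close> has point \<open>p\<close>,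
  scale \<open>s\<close> and children \<open>ts\<close> (in an arbitrary order).
\<close>

datatype 'a ctree = Leaf 'a | Node 'a int "'a ctree list"

fun point :: "'a ctree \<Rightarrow> 'a" where
  "point (Leaf p) = p"
| "point (Node p s ts) = p"

fun node_scale :: "'a ctree \<Rightarrow> ereal" where
  "node_scale (Leaf p) = -\<infinity>"
| "node_scale (Node p s ts) = ereal (real_of_int s)"

fun children :: "'a ctree \<Rightarrow> 'a ctree list" where
  "children (Leaf p) = []"
| "children (Node p s ts) = ts"

text \<open>
  \<open>explicit C par s p T\<close>: coalescing turns the implicit subtree rooted at the level \<open>s\<close> node of
  \<open>p\<close> into \<open>T\<close>. A chain of self-children collapses to its lowest node, which is at scale
  \<open>-\<infinity>\<close> if the chain never ends.
\<close>

inductive explicit ::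
    "(int \<Rightarrow> 'a set) \<Rightarrow> (int \<Rightarrow> 'a \<Rightarrow> 'a) \<Rightarrow> int \<Rightarrow> 'a \<Rightarrow> 'a ctree \<Rightarrow> bool"
  for C :: "int \<Rightarrow> 'a set" and par :: "int \<Rightarrow> 'a \<Rightarrow> 'a" where
  leaf: "(\<forall>t\<le>s. implicit_children C par t p = {p}) \<Longrightarrow> explicit C par s p (Leaf p)"
| coalesce: "implicit_children C par s p = {p} \<Longrightarrow> explicit C par (s - 1) p T
    \<Longrightarrow> explicit C par s p T"
| branch: "implicit_children C par s p = set xs \<Longrightarrow> distinct xs \<Longrightarrow> set xs \<noteq> {p}
    \<Longrightarrow> list_all2 (explicit C par (s - 1)) xs ts
    \<Longrightarrow> explicit C par s p (Node p s ts)"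

definition cover_tree :: "('a \<Rightarrow> 'a \<Rightarrow> real) \<Rightarrow> 'a set \<Rightarrow> 'a ctree \<Rightarrow> bool" where
  "cover_tree d S T \<longleftrightarrow>
     (\<exists>C par r s. implicit_cover_tree d S C par r \<and> C s = {r} \<and> explicit C par s r T)"

fun nonleaf_scales :: "'a ctree \<Rightarrow> int set" where
  "nonleaf_scales (Leaf p) = {}"
| "nonleaf_scales (Node p s ts) = insert s (\<Union>t\<in>set ts. nonleaf_scales t)"

text \<open>The second argument is the scale of the parent, \<open>None\<close> for the root.\<close>

fun node_imbalance :: "int \<Rightarrow> int option \<Rightarrow> 'a ctree \<Rightarrow> int" where
  "node_imbalance smin None T = 0"
| "node_imbalance smin (Some sp) (Leaf p) = max (sp - smin - 1) 0"
| "node_imbalance smin (Some sp) (Node p s ts) = sp - s - 1"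

fun sum_imbalance :: "int \<Rightarrow> int option \<Rightarrow> 'a ctree \<Rightarrow> int" where
  "sum_imbalance smin sp (Leaf p) = node_imbalance smin sp (Leaf p)"
| "sum_imbalance smin sp (Node p s ts) =
     node_imbalance smin sp (Node p s ts) + (\<Sum>t\<leftarrow>ts. sum_imbalance smin (Some s) t)"

definition imbalance :: "'a ctree \<Rightarrow> int" where
  "imbalance T = sum_imbalance (Min (nonleaf_scales T)) None T"

text \<open>The maximum of the empty set of scales is taken to be \<open>-\<infinity>\<close>.\<close>

definition max_scale :: "'a ctree list \<Rightarrow> ereal" where
  "max_scale R = Max (insert (-\<infinity>) (node_scale ` set R))"

definition expand :: "'a ctree list \<Rightarrow> 'a ctree list" where
  "expand R = concat (map children (filter (\<lambda>Nr. node_scale Nr = max_scale R) R))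
              @ filter (\<lambda>Nr. node_scale Nr \<noteq> max_scale R) R"

lemma sum_list_size_children_le: "sum_list (map size (children t)) \<le> size t"
proof (cases t)
  case (Node p s ts)
  have "sum_list (map size ts) \<le> size_list size ts" for ts :: "'a ctree list"
    by (induction ts) auto
  from this[of ts] Node show ?thesis by simp
qed simp

lemma sum_list_size_children_less:
  "node_scale t \<noteq> -\<infinity> \<Longrightarrow> sum_list (map size (children t)) < size t"
proof (cases t)
  case (Node p s ts)
  have "sum_list (map size ts) \<le> size_list size ts" for ts :: "'a ctree list"
    by (induction ts) auto
  from this[of ts] Node show ?thesis by simp
qed simp

lemma sum_list_size_expand:
  assumes "s < max_scale R"
  shows "sum_list (map size (expand R)) < sum_list (map size R)"
proof -
  define f where "f m R = concat (map children (filter (\<lambda>Nr. node_scale Nr = m) R))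
      @ filter (\<lambda>Nr. node_scale Nr \<noteq> m) R" for m and R :: "'a ctree list"
  have le: "sum_list (map size (f m R)) \<le> sum_list (map size R)" for m R
  proof (induction R)
    case (Cons t R)
    then show ?case
      using sum_list_size_children_le[of t] by (auto simp: f_def)
  qed (simp add: f_def)
  have less: "sum_list (map size (f m R)) < sum_list (map size R)"
    if "m \<noteq> -\<infinity>" "m \<in> node_scale ` set R" for m R
    using that
  proof (induction R)
    case (Cons t R)
    show ?case
    proof (cases "node_scale t = m")
      case True
      then show ?thesis
        using sum_list_size_children_less[of t] le[of m R] Cons.prems by (auto simp: f_def)
    next
      case False
      then have "m \<in> node_scale ` set R"
        using Cons.prems by auto
      then show ?thesis
        using Cons.IH Cons.prems False by (auto simp: f_def)
    qed
  qed simp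
  have "max_scale R \<in> insert (-\<infinity>) (node_scale ` set R)"
    unfolding max_scale_def by (rule Max_in) auto
  moreover have "max_scale R \<noteq> -\<infinity>"
    using assms by auto
  ultimately show ?thesis
    using less[of "max_scale R" R] by (auto simp: f_def expand_def)
qed

lemma sum_list_size_filter_le:
  "sum_list (map size (filter P ts)) \<le> sum_list (map size (ts :: 'a ctree list))"
  by (induction ts) auto

lemma size_child_less: "t \<in> set (children N) \<Longrightarrow> size t < size N"
  by (cases N) (auto dest: size_list_estimation'[OF _ order_refl, of _ _ size] simp: less_Suc_eq_le)

text \<open>
  A problem is given by a state type, \<open>base_case p\<^sub>q p\<^sub>r\<close>, which updates the state, and
  \<open>score\<close>, which may read it. The traversal returns the final state and the running time in
  elementary steps. One step is charged for every recursive call, for every node inspected in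
  finding the maximal scale and in splitting off the nodes of that scale, for every call of
  \<open>BaseCase\<close>, and for every call of \<open>Score\<close>. The set of reference nodes is kept as a list.
\<close>

function traverse ::
    "('a \<Rightarrow> 'a \<Rightarrow> 'st \<Rightarrow> 'st) \<Rightarrow> ('st \<Rightarrow> 'a ctree \<Rightarrow> 'a ctree \<Rightarrow> ereal) \<Rightarrow>
     'a ctree \<Rightarrow> 'a ctree list \<Rightarrow> 'st \<Rightarrow> 'st \<times> nat" where
  "traverse base_case score Nq R st =
     (if node_scale Nq < max_scale R then
        let st1 = fold (\<lambda>Nr. base_case (point Nq) (point Nr)) R st;
            R' = filter (\<lambda>Nr. score st1 Nq Nr \<noteq> \<infinity>) (expand R);
            (st2, t) = traverse base_case score Nq R' st1
        in (st2, 1 + 3 * length R + length (expand R) + t)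
      else
        fold (\<lambda>Nqc (st1, t1).
            let R' = filter (\<lambda>Nr. score st1 Nqc Nr \<noteq> \<infinity>) R;
                (st2, t2) = traverse base_case score Nqc R' st1
            in (st2, t1 + length R + t2))
          (children Nq) (st, 1 + length R))"
  by pat_completeness auto
termination
proof (relation "measures [\<lambda>(_, _, Nq, _, _). size Nq, \<lambda>(_, _, _, R, _). sum_list (map size R)]",
    goal_cases)
  case 1
  show ?case by simp
next
  case (2 base_case score Nq R st st1 R')
  then show ?case
    using sum_list_size_expand[of "node_scale Nq" R] sum_list_size_filter_le
    by (auto intro: le_less_trans)
next
  case 3
  then show ?case
    by (auto dest: size_child_less)
qed

declare traverse.simps [simp del]

record 'a nn_state =
  nn_dist :: "'a \<Rightarrow> ereal"
  nn_cand :: "'a \<Rightarrow> 'a option"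
  nn_called :: "('a \<times> 'a) set"

definition nn_init :: "'a nn_state" where
  "nn_init = \<lparr>nn_dist = (\<lambda>_. \<infinity>), nn_cand = (\<lambda>_. None), nn_called = {}\<rparr>"

definition nn_base_case ::
    "('a \<Rightarrow> 'a \<Rightarrow> real) \<Rightarrow> 'a \<Rightarrow> 'a \<Rightarrow> 'a nn_state \<Rightarrow> 'a nn_state" where
  "nn_base_case d pq pr st =
     (let st' = (if ereal (d pq pr) < nn_dist st pq \<and> (pq, pr) \<notin> nn_called st
                 then st\<lparr>nn_dist := (nn_dist st)(pq := ereal (d pq pr)),
                         nn_cand := (nn_cand st)(pq := Some pr)\<rparr>
                 else st)
      in st'\<lparr>nn_called := insert (pq, pr) (nn_called st')\<rparr>)"

text \<open>The bound \<open>2\<^bsup>s+1\<^esup>\<close> on the distance from the point of a node to its descendants\<close>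

fun radius :: "'a ctree \<Rightarrow> real" where
  "radius (Leaf p) = 0"
| "radius (Node p s ts) = 2 powi (s + 1)"

definition d_min :: "('a \<Rightarrow> 'a \<Rightarrow> real) \<Rightarrow> 'a ctree \<Rightarrow> 'a ctree \<Rightarrow> real" where
  "d_min d Nq Nr = d (point Nq) (point Nr) - radius Nq - radius Nr"

definition nn_bound :: "'a nn_state \<Rightarrow> 'a ctree \<Rightarrow> ereal" where
  "nn_bound st Nq = nn_dist st (point Nq) + ereal (radius Nq)"

definition nn_score ::
    "('a \<Rightarrow> 'a \<Rightarrow> real) \<Rightarrow> 'a nn_state \<Rightarrow> 'a ctree \<Rightarrow> 'a ctree \<Rightarrow> ereal" where
  "nn_score d st Nq Nr =
     (if ereal (d_min d Nq Nr) < nn_bound st Nq then ereal (d_min d Nq Nr) else \<infinity>)"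

definition nn_time :: "('a \<Rightarrow> 'a \<Rightarrow> real) \<Rightarrow> 'a ctree \<Rightarrow> 'a ctree \<Rightarrow> nat" where
  "nn_time d Tq Tr = snd (traverse (nn_base_case d) (nn_score d) Tq [Tr] nn_init)"

definition c_qr :: "('a \<Rightarrow> 'a \<Rightarrow> real) \<Rightarrow> 'a set \<Rightarrow> 'a set \<Rightarrow> real" where
  "c_qr d Sq Sr =
     max (Max ((\<lambda>pq. expansion_constant d (insert pq Sr)) ` Sq)) (expansion_constant d Sr)"

definition theta :: "('a \<Rightarrow> 'a \<Rightarrow> real) \<Rightarrow> 'a set \<Rightarrow> 'a set \<Rightarrow> real" where
  "theta d Sq Sr =
     max (min (real (card Sr) * log 2 (min_nonzero_dist d Sq / min_nonzero_dist d Sr))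
              ((real (card Sr))\<^sup>2))
         0"

end

theory Submission
  imports Defs
begin

text \<open>
  A reference recursion at scale \<open>s\<close> with query point \<open>a\<close> first brings the candidate distance of
  \<open>a\<close> within \<open>2\<^bsup>s+1\<^esup>\<close> of the nearest neighbor distance \<open>\<delta>\<close>, so the nodes that survive pruning are
  \<open>2\<^bsup>s-1\<^esup>\<close>-separated and lie within \<open>\<delta> + 5 \<sqdot> 2\<^sup>s\<close> of \<open>a\<close>. If \<open>\<delta> \<ge> 2\<^sup>s / 4\<close>, growing the ball of radius
  less than \<open>\<delta>\<close> around \<open>a\<close> five times captures all of them; otherwise they are counted by packing
  in \<open>S\<^sub>r\<close>. If the largest scale \<open>m\<close> of a survivor is small, so is the radius of
  the survivor that contains the nearest neighbor, and the distance bound sharpens to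
  \<open>\<delta> + 3 \<sqdot> 2\<^sup>s + 2\<^bsup>m+2\<^esup>\<close>; without this the exponents would not stay at 4 and 5.
  Every call thus costs \<open>O(c\<^sub>r\<^sup>4 c\<^sub>q\<^sub>r\<^sup>5)\<close>.

  A query node with parent scale \<open>s\<^sub>p\<close> and scale \<open>s\<^sub>q\<close> sees only reference recursions at scales
  in \<open>(s\<^sub>q, s\<^sub>p]\<close>, one more than its imbalance. For leaves the scales of \<open>T\<^sub>r\<close> below the smallest scale of
  \<open>T\<^sub>q\<close> come on top; their number is at most \<open>log\<^sub>2 (\<delta>\<^sub>q / \<delta>\<^sub>r) + 1\<close> and at most \<open>N\<close>, whence \<open>\<theta>\<close>.
\<close>

section \<open>Levels of a cover tree\<close>

text \<open>Every point of an explicit tree reappears in a leaf at the end of its chain of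
  self-children, so these are all the descendant points of the node.\<close>

fun leaf_points :: "'a ctree \<Rightarrow> 'a set" where
  "leaf_points (Leaf p) = {p}"
| "leaf_points (Node p s ts) = (\<Union>t\<in>set ts. leaf_points t)"

fun num_leaves :: "'a ctree \<Rightarrow> nat" where
  "num_leaves (Leaf p) = 1"
| "num_leaves (Node p s ts) = (\<Sum>t\<leftarrow>ts. num_leaves t)"

fun num_nodes :: "'a ctree \<Rightarrow> nat" where
  "num_nodes (Leaf p) = 1"
| "num_nodes (Node p s ts) = 1 + (\<Sum>t\<leftarrow>ts. num_nodes t)"

text \<open>Fixes the implicit tree behind one \<open>cover_tree\<close>, so that it can be
  interpreted once for the reference set and once for the query set.\<close>

locale cover_tree_levels = Metric_space M d
  for M :: "'a set" and d +
  fixes S :: "'a set" and C :: "int \<Rightarrow> 'a set" and par :: "int \<Rightarrow> 'a \<Rightarrow> 'a" and r :: 'a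
  assumes finite_S: "finite S" and S_subset: "S \<subseteq> M"
    and implicit: "implicit_cover_tree d S C par r"
begin

lemma nested: "p \<in> C s \<Longrightarrow> p \<in> C (s - 1)"
  using implicit by (auto simp: implicit_cover_tree_def)

lemma parent_in: "p \<in> C (s - 1) \<Longrightarrow> par s p \<in> C s"
  and parent_dist: "p \<in> C (s - 1) \<Longrightarrow> d p (par s p) < 2 powi s"
  and separated: "p \<in> C s \<Longrightarrow> p' \<in> C s \<Longrightarrow> p \<noteq> p' \<Longrightarrow> d p p' > 2 powi s"
  using implicit by (auto simp: implicit_cover_tree_def)

lemma Union_levels: "(\<Union>s. C s) = S"
  using implicit by (auto simp: implicit_cover_tree_def)

lemma level_subset: "C s \<subseteq> S"
  using Union_levels by blast

lemma level_antimono: "s \<le> t \<Longrightarrow> C t \<subseteq> C s"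
proof (induction s rule: int_le_induct)
  case (step i)
  then show ?case using nested[of _ i] by blast
qed simp

text \<open>Covering would put a different parent closer than \<open>2 powi s\<close>, separation
  farther away.\<close>

lemma parent_self:
  assumes "p \<in> C s"
  shows "par s p = p"
proof (rule ccontr)
  assume neq: "par s p \<noteq> p"
  have "p \<in> C (s - 1)" using nested[OF assms] .
  then have "d p (par s p) < 2 powi s" "par s p \<in> C s"
    using parent_dist parent_in by auto
  with separated[OF assms, of "par s p"] neq show False by auto
qed

text \<open>Coalescing makes one explicit node stand for a run of implicit levels, so
  \<open>N\<close> does not determine \<open>t\<close>. Reference nodes of different scales can thus
  be treated as nodes of one common, separated level.\<close>

definition at_level :: "int \<Rightarrow> 'a ctree \<Rightarrow> bool" where
  "at_level t N \<longleftrightarrow> point N \<in> C t \<and> explicit C par t (point N) N"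

lemma explicit_point: "explicit C par t p N \<Longrightarrow> point N = p"
  by (induction rule: explicit.induct) auto

lemma explicit_scale: "explicit C par t p N \<Longrightarrow> node_scale N \<le> ereal (real_of_int t)"
proof (induction rule: explicit.induct)
  case (coalesce s p T)
  show ?case by (rule order_trans[OF coalesce.IH]) simp
qed auto

lemma at_level_scale: "at_level t N \<Longrightarrow> node_scale N \<le> ereal (real_of_int t)"
  using explicit_scale by (auto simp: at_level_def)

lemma at_level_point: "at_level t N \<Longrightarrow> point N \<in> C t"
  by (simp add: at_level_def)

lemma at_level_point_S: "at_level t N \<Longrightarrow> point N \<in> S"
  using at_level_point level_subset by blast

lemma at_level_pred:
  assumes "at_level t N" "node_scale N \<le> ereal (real_of_int (t - 1))"
  shows "at_level (t - 1) N"
proof -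
  have "explicit C par (t - 1) p N" if "explicit C par t p N" for p
    using that assms(2) by cases (auto intro: explicit.leaf)
  then have "explicit C par (t - 1) (point N) N"
    using assms(1) by (simp add: at_level_def)
  then show ?thesis using assms(1) nested[of "point N" t] by (auto simp: at_level_def)
qed

lemma at_level_lower:
  assumes "at_level t N" "node_scale N \<le> ereal (real_of_int u)" "u \<le> t"
  shows "at_level u N"
  using assms(3,2)
proof (induction u rule: int_le_induct)
  case base
  then show ?case using assms(1) by simp
next
  case (step i)
  have "ereal (real_of_int (i - 1)) \<le> ereal (real_of_int i)" by simp
  then have "node_scale N \<le> ereal (real_of_int i)" using step.prems by (rule order_trans[rotated])
  then have "at_level i N" by (rule step.IH)
  then show ?case using step.prems by (rule at_level_pred)
qed

lemma at_level_Node: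
  assumes "at_level t (Node p s ts)"
  shows "s \<le> t" "p \<in> C s" "distinct (map point ts)"
    "set (map point ts) = implicit_children C par s p" "implicit_children C par s p \<noteq> {p}"
    "\<And>c. c \<in> set ts \<Longrightarrow> at_level (s - 1) c"
proof -
  show "s \<le> t" using at_level_scale[OF assms] by simp
  then have lev: "at_level s (Node p s ts)"
    by (intro at_level_lower[OF assms]) simp_all
  show p: "p \<in> C s" using lev by (simp add: at_level_def)
  have "explicit C par s p (Node p s ts)" using lev by (simp add: at_level_def)
  \<comment> \<open>The \<open>coalesce\<close> case would place a node of scale \<open>s\<close> at
    level \<open>s - 1\<close>, against \<open>explicit_scale\<close>.\<close>
  then obtain xs where xs: "implicit_children C par s p = set xs" "distinct xs" "set xs \<noteq> {p}"
    "list_all2 (explicit C par (s - 1)) xs ts"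
    by cases (use explicit_scale in fastforce)+
  have "map point ts = xs"
    using xs(4) by (auto simp: list_all2_conv_all_nth intro!: nth_equalityI explicit_point)
  then show "distinct (map point ts)" "set (map point ts) = implicit_children C par s p"
    "implicit_children C par s p \<noteq> {p}"
    using xs by auto
  fix c assume c: "c \<in> set ts"
  then obtain i where i: "i < length ts" "c = ts ! i" by (metis in_set_conv_nth)
  then have e: "explicit C par (s - 1) (xs ! i) c" "xs ! i \<in> set xs"
    using xs(4) by (auto simp: list_all2_conv_all_nth)
  then have "xs ! i \<in> C (s - 1)" using xs(1) by (auto simp: implicit_children_def)
  then show "at_level (s - 1) c" using e explicit_point by (auto simp: at_level_def)
qed

text \<open>Ancestors are followed in the implicit tree, where every level is present;
  \<open>refl\<close> allows the ascent to start at any level that contains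
  \<open>q\<close>.\<close>

inductive ancestor :: "int \<Rightarrow> 'a \<Rightarrow> 'a \<Rightarrow> bool" where
  refl: "q \<in> C t \<Longrightarrow> ancestor t q q"
| up: "ancestor (t - 1) q x \<Longrightarrow> ancestor t q (par t x)"

lemma ancestor_in: "ancestor t q p \<Longrightarrow> p \<in> C t"
  by (induction rule: ancestor.induct) (auto intro: parent_in)

lemma ancestor_source: "ancestor t q p \<Longrightarrow> q \<in> S"
  by (induction rule: ancestor.induct) (use level_subset in auto)

lemma ancestor_of_level: "ancestor t q p \<Longrightarrow> q \<in> C t \<Longrightarrow> p = q"
proof (induction rule: ancestor.induct)
  case (up t q x)
  then have "x = q" using nested[of q t] by blast
  then show ?case using up parent_self by simp
qed simp

lemma ancestor_unique: "ancestor t q p \<Longrightarrow> ancestor t q p' \<Longrightarrow> p = p'"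
proof (induction arbitrary: p' rule: ancestor.induct)
  case (refl q t)
  then show ?case using ancestor_of_level by blast
next
  case (up t q x)
  from up.prems show ?case
  proof cases
    case refl
    then show ?thesis using ancestor.up[OF up.hyps] ancestor_of_level by blast
  next
    case (up y)
    then show ?thesis using up.IH \<open>\<And>p'. ancestor (t - 1) q p' \<Longrightarrow> x = p'\<close> by simp
  qed
qed

text \<open>The ascent to level \<open>t\<close> has steps shorter than \<open>2 powi t\<close>,
  \<open>2 powi (t - 1)\<close> and so on, a geometric series.\<close>

lemma ancestor_dist: "ancestor t q p \<Longrightarrow> d q p < 2 powi (t + 1)"
proof (induction rule: ancestor.induct)
  case (refl q t)
  then show ?case using level_subset S_subset by (subst zero[THEN iffD2]) auto
next
  case (up t q x)
  have x: "x \<in> C (t - 1)" using up.hyps ancestor_in by simp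
  have M: "q \<in> M" "x \<in> M" "par t x \<in> M"
    using ancestor_source[OF up.hyps] x parent_in[OF x] level_subset S_subset by blast+
  have "d q (par t x) \<le> d q x + d x (par t x)" using M triangle by blast
  also have "\<dots> < 2 powi t + 2 powi t" using up.IH parent_dist[OF x] by simp
  also have "\<dots> = 2 powi (t + 1)" by (simp add: power_int_add)
  finally show ?case .
qed

lemma ancestor_step_down:
  assumes "ancestor t q p"
  obtains x where "x \<in> implicit_children C par t p" "ancestor (t - 1) q x"
  using assms
proof cases
  case refl
  then have "p \<in> C (t - 1)" "par t p = p" using nested parent_self by auto
  then show ?thesis using refl that[of p] by (auto simp: implicit_children_def intro: ancestor.refl)
next
  case (up x)
  then show ?thesis using that[of x] ancestor_in[of "t - 1" q x] by (auto simp: implicit_children_def)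
qed

lemma ancestor_leaf_points: "at_level t N \<Longrightarrow> q \<in> leaf_points N \<Longrightarrow> ancestor t q (point N)"
proof -
  have "explicit C par t p N \<Longrightarrow> p \<in> C t \<Longrightarrow> q \<in> leaf_points N \<Longrightarrow> ancestor t q p" for p
  proof (induction rule: explicit.induct)
    case (leaf s p)
    then show ?case by (auto intro: ancestor.refl)
  next
    case (coalesce s p T)
    then have "ancestor (s - 1) q p" using nested[of p s] by blast
    then show ?case using ancestor.up parent_self[OF coalesce.prems(1)] by metis
  next
    case (branch s p xs ts)
    then obtain c where c: "c \<in> set ts" "q \<in> leaf_points c" by auto
    then obtain i where i: "i < length ts" "c = ts ! i" by (metis in_set_conv_nth)
    then have x: "xs ! i \<in> implicit_children C par s p"
      using branch by (auto simp: list_all2_conv_all_nth)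
    then have "ancestor (s - 1) q (xs ! i)"
      using branch.IH i c by (auto simp: list_all2_conv_all_nth implicit_children_def)
    then have "ancestor s q (par s (xs ! i))" by (rule ancestor.up)
    then show ?case using x by (simp add: implicit_children_def)
  qed
  then show "at_level t N \<Longrightarrow> q \<in> leaf_points N \<Longrightarrow> ancestor t q (point N)"
    by (auto simp: at_level_def)
qed

text \<open>Descends along the ancestors of \<open>q\<close>. At a leaf all lower levels consist of
  self-children only, so nothing but the point itself can have it as an ancestor.\<close>

lemma leaf_points_ancestor: "at_level t N \<Longrightarrow> ancestor t q (point N) \<Longrightarrow> q \<in> leaf_points N"
proof -
  have "explicit C par t p N \<Longrightarrow> ancestor t q p \<Longrightarrow> q \<in> leaf_points N" for p
  proof (induction rule: explicit.induct)
    case (leaf s p)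
    have "ancestor t q p' \<Longrightarrow> p' = p \<Longrightarrow> t \<le> s \<Longrightarrow> q = p" for t p'
    proof (induction rule: ancestor.induct)
      case (up t q x)
      then have "x \<in> implicit_children C par t p"
        using ancestor_in by (auto simp: implicit_children_def)
      then show ?case using leaf.hyps up by auto
    qed simp
    then show ?case using leaf.prems by auto
  next
    case (coalesce s p T)
    then show ?case by (metis ancestor_step_down singletonD)
  next
    case (branch s p xs ts)
    obtain x where x: "x \<in> set xs" "ancestor (s - 1) q x"
      using branch ancestor_step_down by metis
    then obtain i where "i < length xs" "x = xs ! i" by (metis in_set_conv_nth)
    then have "i < length ts" "q \<in> leaf_points (ts ! i)"
      using branch.IH x by (auto simp: list_all2_conv_all_nth)
    then show ?case by (auto intro!: bexI[of _ "ts ! i"])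
  qed
  then show "at_level t N \<Longrightarrow> ancestor t q (point N) \<Longrightarrow> q \<in> leaf_points N"
    by (auto simp: at_level_def)
qed

lemma leaf_points_iff: "at_level t N \<Longrightarrow> q \<in> leaf_points N \<longleftrightarrow> ancestor t q (point N)"
  using ancestor_leaf_points leaf_points_ancestor by blast

lemma leaf_points_subset: "at_level t N \<Longrightarrow> leaf_points N \<subseteq> S"
  using leaf_points_iff ancestor_source by blast

lemma point_in_leaf_points: "at_level t N \<Longrightarrow> point N \<in> leaf_points N"
  using leaf_points_iff at_level_point ancestor.refl by blast

lemma leaf_points_level: "at_level t N \<Longrightarrow> q \<in> leaf_points N \<Longrightarrow> q \<in> C t \<Longrightarrow> q = point N"
  using leaf_points_iff ancestor_of_level by blast

lemma leaf_points_disjoint: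
  "at_level t N \<Longrightarrow> at_level t N' \<Longrightarrow> point N \<noteq> point N' \<Longrightarrow> leaf_points N \<inter> leaf_points N' = {}"
  using leaf_points_iff ancestor_unique by blast

lemma leaf_points_root:
  assumes "at_level t N" "C t = {point N}"
  shows "leaf_points N = S"
proof
  show "leaf_points N \<subseteq> S" using assms leaf_points_subset by blast
  show "S \<subseteq> leaf_points N"
  proof
    fix q assume "q \<in> S"
    then obtain u where u: "q \<in> C u" using Union_levels by blast
    \<comment> \<open>The ascent starts at \<open>min u t\<close> because \<open>q\<close> may enter
      the tree only below level \<open>t\<close>.\<close>
    have "\<exists>p. ancestor (min u t) q p"
      using u level_antimono[of "min u t" u] by (auto intro!: exI[of _ q] ancestor.refl)
    moreover have "min u t \<le> v \<Longrightarrow> \<exists>p. ancestor (min u t) q p \<Longrightarrow> \<exists>p. ancestor v q p" for v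
    proof (induction v rule: int_ge_induct)
      case (step i)
      then obtain p where "ancestor i q p" by blast
      then show ?case using ancestor.up[of "i + 1" q p] by auto
    qed simp
    ultimately obtain p where "ancestor t q p" using min.cobounded2 by blast
    then show "q \<in> leaf_points N"
      using assms ancestor_in[of t q p] by (auto simp: leaf_points_iff)
  qed
qed

text \<open>At a leaf both sides are 0; elsewhere the inequality is strict, and
  \<open>pruned_done\<close> depends on this strictness.\<close>

lemma radius_bound:
  assumes "at_level t N" "q \<in> leaf_points N"
  shows "d q (point N) \<le> radius N" "children N \<noteq> [] \<Longrightarrow> d q (point N) < radius N"
proof -
  have "d q (point N) < radius N" if "N = Node p s ts" for p s ts
    using that assms at_level_lower[of t N s] at_level_scale[of t N] leaf_points_iff[of s N q] ancestor_dist
    by fastforce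
  moreover have "d q (point N) = 0" if "N = Leaf p" for p
    using that assms at_level_point_S[OF assms(1)] S_subset by (auto simp: subset_iff)
  ultimately show "d q (point N) \<le> radius N" "children N \<noteq> [] \<Longrightarrow> d q (point N) < radius N"
    by (cases N; fastforce)+
qed

section \<open>Counting leaves, nodes and scales\<close>

lemma finite_leaf_points: "finite (leaf_points N)"
  by (induction N) auto

lemma num_leaves_eq_card: "at_level t N \<Longrightarrow> num_leaves N = card (leaf_points N)"
proof (induction N arbitrary: t)
  case (Node p s ts)
  note lev = at_level_Node[OF Node.prems]
  have inj: "inj_on point (set ts)" using lev(3) by (simp add: distinct_map)
  have "num_leaves (Node p s ts) = (\<Sum>t\<in>set ts. num_leaves t)"
    using lev(3) by (simp add: sum_list_distinct_conv_sum_set distinct_map)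
  also have "\<dots> = (\<Sum>t\<in>set ts. card (leaf_points t))"
    using Node.IH lev(6) by (intro sum.cong) auto
  also have "\<dots> = card (\<Union>t\<in>set ts. leaf_points t)"
  proof (rule card_UN_disjoint[symmetric])
    show "\<forall>c\<in>set ts. \<forall>c'\<in>set ts. c \<noteq> c' \<longrightarrow> leaf_points c \<inter> leaf_points c' = {}"
      using leaf_points_disjoint[OF lev(6) lev(6)] inj by (auto simp: inj_on_def)
  qed (use finite_leaf_points in auto)
  finally show ?case by simp
qed simp

text \<open>The self-child is always present, and coalescing rules out that it is alone.\<close>

lemma two_children:
  assumes "at_level t (Node p s ts)"
  shows "2 \<le> length ts"
proof -
  note lev = at_level_Node[OF assms]
  have "p \<in> set (map point ts)"
    using lev(2,4) nested[of p s] parent_self by (auto simp: implicit_children_def)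
  moreover have "set (map point ts) \<noteq> {p}" using lev(4,5) by simp
  ultimately show ?thesis
    by (cases ts; cases "tl ts") auto
qed

text \<open>Summing over the children leaves a surplus of \<open>length ts\<close>, which is at
  least 2 and pays for the node itself and for the \<open>+ 1\<close>.\<close>

lemma num_nodes_le: "at_level t N \<Longrightarrow> num_nodes N + 1 \<le> 2 * num_leaves N"
proof (induction N arbitrary: t)
  case (Node p s ts)
  note lev = at_level_Node[OF Node.prems]
  have "num_nodes c + 1 \<le> 2 * num_leaves c" if "c \<in> set ts" for c
    using that Node.IH lev(6) by blast
  then have "(\<Sum>c\<leftarrow>ts. num_nodes c + 1) \<le> (\<Sum>c\<leftarrow>ts. 2 * num_leaves c)"
    by (intro sum_list_mono) auto
  then have "sum_list (map num_nodes ts) + length ts \<le> 2 * sum_list (map num_leaves ts)"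
    by (simp add: sum_list_addf sum_list_triv sum_list_const_mult del: One_nat_def)
  then show ?case using two_children[OF Node.prems] by simp
qed simp

lemma finite_nonleaf_scales: "finite (nonleaf_scales N)"
  by (induction N) auto

text \<open>Fewer scales than points: this is the source of the \<open>N\<^sup>2\<close> alternative
  in \<open>theta\<close>.\<close>

lemma card_nonleaf_scales: "at_level t N \<Longrightarrow> card (nonleaf_scales N) + 1 \<le> num_leaves N"
proof (induction N arbitrary: t)
  case (Node p s ts)
  note lev = at_level_Node[OF Node.prems]
  have "card (\<Union>c\<in>set ts. nonleaf_scales c) \<le> (\<Sum>c\<in>set ts. card (nonleaf_scales c))"
    by (rule card_UN_le) simp
  moreover have "card (nonleaf_scales (Node p s ts)) \<le> Suc (card (\<Union>c\<in>set ts. nonleaf_scales c))"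
    by (simp add: card_insert_le_m1 card_insert_if finite_nonleaf_scales)
  moreover have "(\<Sum>c\<in>set ts. card (nonleaf_scales c) + 1) \<le> (\<Sum>c\<in>set ts. num_leaves c)"
    using Node.IH lev(6) by (intro sum_mono) auto
  then have "(\<Sum>c\<in>set ts. card (nonleaf_scales c)) + length ts \<le> num_leaves (Node p s ts)"
    using lev(3) by (simp add: sum_list_distinct_conv_sum_set distinct_map sum.distrib distinct_card
        del: One_nat_def)
  ultimately show ?case using two_children[OF Node.prems] by linarith
qed simp

lemma nonleaf_scales_le: "at_level t N \<Longrightarrow> \<sigma> \<in> nonleaf_scales N \<Longrightarrow> \<sigma> \<le> t"
proof (induction N arbitrary: t)
  case (Node p s ts)
  note lev = at_level_Node[OF Node.prems(1)]
  show ?case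
  proof (cases "\<sigma> = s")
    case False
    then obtain c where "c \<in> set ts" "\<sigma> \<in> nonleaf_scales c" using Node.prems by auto
    then have "\<sigma> \<le> s - 1" using Node.IH lev(6) by blast
    then show ?thesis using lev(1) by simp
  qed (use lev in simp)
qed simp

text \<open>Nothing branches below the smallest non-leaf scale \<open>m\<close>, so all points are
  already present at level \<open>m - 1\<close>.\<close>

lemma leaf_points_in_bottom_level:
  "at_level t N \<Longrightarrow> \<forall>\<sigma>\<in>nonleaf_scales N. m \<le> \<sigma> \<Longrightarrow> m - 1 \<le> t \<Longrightarrow> leaf_points N \<subseteq> C (m - 1)"
proof (induction N arbitrary: t)
  case (Leaf p)
  then show ?case using at_level_point[of t "Leaf p"] level_antimono[of "m - 1" t] by auto
next
  case (Node p s ts)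
  note lev = at_level_Node[OF Node.prems(1)]
  have "leaf_points c \<subseteq> C (m - 1)" if "c \<in> set ts" for c
    using that Node.prems(2) by (intro Node.IH[OF _ lev(6)]) auto
  then show ?case by auto
qed

text \<open>A non-leaf node has a child with a different point, and covering keeps that point close
  to its own.\<close>

lemma close_pair_of_scale:
  "at_level t N \<Longrightarrow> \<sigma> \<in> nonleaf_scales N \<Longrightarrow> \<exists>x\<in>S. \<exists>y\<in>S. x \<noteq> y \<and> d x y < 2 powi \<sigma>"
proof (induction N arbitrary: t)
  case (Node p s ts)
  note lev = at_level_Node[OF Node.prems(1)]
  show ?case
  proof (cases "\<sigma> = s")
    case True
    have "p \<in> implicit_children C par s p"
      using lev(2) nested[of p s] parent_self by (auto simp: implicit_children_def)
    then obtain x where x: "x \<in> C (s - 1)" "par s x = p" "x \<noteq> p"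
      using lev(5) by (auto simp: implicit_children_def)
    then show ?thesis
      using True parent_dist[of x s] lev(2) level_subset by (intro bexI[of _ x] bexI[of _ p]) auto
  next
    case False
    then obtain c where c: "c \<in> set ts" "\<sigma> \<in> nonleaf_scales c" using Node.prems by auto
    then show ?thesis using Node.IH lev(6) by blast
  qed
qed simp

end

section \<open>Expansion constants and packing\<close>

text \<open>The \<open>LEAST\<close> is attained: it is the supremum of 2 and all ratios of ball
  sizes, which are at most \<open>card S\<close> because each ball contains its center.\<close>

lemma expansion_constant_props:
  assumes "finite S" and zero: "\<And>p. p \<in> S \<Longrightarrow> d p p = (0::real)"
  shows "expansion_constant d S \<ge> 2"
    and "p \<in> S \<Longrightarrow> \<Delta> > 0 \<Longrightarrow>
      real (card (set_ball d S p (2 * \<Delta>))) \<le> expansion_constant d S * real (card (set_ball d S p \<Delta>))"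
proof -
  define ball where "ball p \<Delta> = real (card (set_ball d S p \<Delta>))" for p \<Delta>
  define Q where "Q = {ball p (2 * \<Delta>) / ball p \<Delta> | p \<Delta>. p \<in> S \<and> \<Delta> > 0}"
  define c where "c = Sup (insert 2 Q)"
  have pos: "ball p \<Delta> \<ge> 1" if "p \<in> S" "\<Delta> > 0" for p \<Delta>
  proof -
    have "p \<in> set_ball d S p \<Delta>" "finite (set_ball d S p \<Delta>)"
      using that zero assms(1) by (auto simp: set_ball_def)
    then have "card (set_ball d S p \<Delta>) \<noteq> 0" by auto
    then show ?thesis by (simp add: ball_def)
  qed
  have "ball p (2 * \<Delta>) / ball p \<Delta> \<le> real (card S)" if "p \<in> S" "\<Delta> > 0" for p \<Delta>
  proof -
    have "ball p (2 * \<Delta>) \<le> real (card S)"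
      using assms(1) by (auto simp: ball_def set_ball_def intro!: card_mono)
    moreover have "ball p (2 * \<Delta>) / ball p \<Delta> \<le> ball p (2 * \<Delta>) / 1"
      using pos[OF that] by (intro divide_left_mono) (auto simp: ball_def)
    ultimately show ?thesis by simp
  qed
  then have bdd: "bdd_above (insert 2 Q)"
    by (subst bdd_above_insert, intro bdd_aboveI[of _ "real (card S)"]) (auto simp: Q_def)
  have iff: "(2 \<le> y \<and> (\<forall>p\<in>S. \<forall>\<Delta>>0. ball p (2 * \<Delta>) \<le> y * ball p \<Delta>)) \<longleftrightarrow> c \<le> y" for y
  proof -
    have "c \<le> y \<longleftrightarrow> (\<forall>x\<in>insert 2 Q. x \<le> y)"
      unfolding c_def using bdd by (intro cSup_le_iff) auto
    also have "\<dots> \<longleftrightarrow> 2 \<le> y \<and> (\<forall>p\<in>S. \<forall>\<Delta>>0. ball p (2 * \<Delta>) / ball p \<Delta> \<le> y)"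
      by (auto simp: Q_def)
    also have "\<dots> \<longleftrightarrow> 2 \<le> y \<and> (\<forall>p\<in>S. \<forall>\<Delta>>0. ball p (2 * \<Delta>) \<le> y * ball p \<Delta>)"
      using pos by (fastforce simp: pos_divide_le_eq)
    finally show ?thesis by simp
  qed
  have "expansion_constant d S = c"
    unfolding expansion_constant_def ball_def[symmetric] iff by (rule Least_equality) auto
  moreover have "2 \<le> c \<and> (\<forall>p\<in>S. \<forall>\<Delta>>0. ball p (2 * \<Delta>) \<le> c * ball p \<Delta>)"
    by (simp add: iff)
  ultimately show "expansion_constant d S \<ge> 2"
    "p \<in> S \<Longrightarrow> \<Delta> > 0 \<Longrightarrow>
      real (card (set_ball d S p (2 * \<Delta>))) \<le> expansion_constant d S * real (card (set_ball d S p \<Delta>))"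
    by (auto simp: ball_def)
qed

lemma expansion_constant_iterate:
  assumes "finite S" "\<And>p. p \<in> S \<Longrightarrow> d p p = (0::real)" "p \<in> S" "\<Delta> > 0"
  shows "real (card (set_ball d S p (2 ^ k * \<Delta>))) \<le> expansion_constant d S ^ k * real (card (set_ball d S p \<Delta>))"
proof (induction k)
  case (Suc k)
  note ec = expansion_constant_props[of S d, OF assms(1,2)]
  have "real (card (set_ball d S p (2 ^ Suc k * \<Delta>)))
      \<le> expansion_constant d S * real (card (set_ball d S p (2 ^ k * \<Delta>)))"
    using ec(2)[of p "2 ^ k * \<Delta>"] assms(3,4) by (simp add: mult.assoc)
  also have "\<dots> \<le> expansion_constant d S * (expansion_constant d S ^ k * real (card (set_ball d S p \<Delta>)))"
    using Suc ec(1) by (intro mult_left_mono) auto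
  finally show ?case by (simp add: mult.assoc)
qed simp

context Metric_space
begin

text \<open>Comparing all balls with the smallest of the disjoint balls of radius \<open>\<rho>\<close>.\<close>

lemma separated_card_le:
  assumes S: "finite S" "S \<subseteq> M" and X: "X \<subseteq> S" and "\<rho> > 0"
    and sep: "\<And>x y. x \<in> X \<Longrightarrow> y \<in> X \<Longrightarrow> x \<noteq> y \<Longrightarrow> d x y > 2 * \<rho>"
    and diam: "\<And>x y. x \<in> X \<Longrightarrow> y \<in> X \<Longrightarrow> d x y + \<rho> \<le> 2 ^ k * \<rho>"
  shows "real (card X) \<le> expansion_constant d S ^ k"
proof (cases "X = {}")
  case True
  have "expansion_constant d S \<ge> 2"
    using S by (intro expansion_constant_props(1)) auto
  then show ?thesis using True by simp
next
  case False
  have zero': "\<And>p. p \<in> S \<Longrightarrow> d p p = 0" using S by auto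
  have finX: "finite X" using X S finite_subset by blast
  define B where "B x = set_ball d S x \<rho>" for x
  have finB: "finite (B x)" for x using S by (simp add: B_def set_ball_def)
  obtain x0 where x0: "x0 \<in> X" "\<And>x. x \<in> X \<Longrightarrow> card (B x0) \<le> card (B x)"
    using that[of "arg_min_on (\<lambda>x. card (B x)) X"] arg_min_if_finite(1)[OF finX False]
      arg_min_least[OF finX False, of _ "\<lambda>x. card (B x)"] by blast
  have "x0 \<in> B x0" using x0 X zero' \<open>\<rho> > 0\<close> by (auto simp: B_def set_ball_def)
  then have pos: "card (B x0) > 0" using finB by (auto simp: card_gt_0_iff)
  have disj: "B x \<inter> B y = {}" if "x \<in> X" "y \<in> X" "x \<noteq> y" for x y
  proof -
    have "d x y \<le> 2 * \<rho>" if "z \<in> B x" "z \<in> B y" for z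
    proof -
      have "d x y \<le> d x z + d z y"
        using that \<open>x \<in> X\<close> \<open>y \<in> X\<close> X S by (intro triangle) (auto simp: B_def set_ball_def)
      then show ?thesis using that by (auto simp: B_def set_ball_def commute)
    qed
    then show ?thesis using sep[OF that] by force
  qed
  have sub: "(\<Union>x\<in>X. B x) \<subseteq> set_ball d S x0 (2 ^ k * \<rho>)"
  proof
    fix z assume "z \<in> (\<Union>x\<in>X. B x)"
    then obtain x where x: "x \<in> X" "z \<in> S" "d x z \<le> \<rho>" by (auto simp: B_def set_ball_def)
    have "d x0 z \<le> d x0 x + d x z" using x x0 X S by (intro triangle) auto
    then have "d x0 z \<le> 2 ^ k * \<rho>" using x diam[OF x0(1) x(1)] by linarith
    then show "z \<in> set_ball d S x0 (2 ^ k * \<rho>)" using x by (simp add: set_ball_def)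
  qed
  have "card X * card (B x0) = (\<Sum>x\<in>X. card (B x0))" by simp
  also have "\<dots> \<le> (\<Sum>x\<in>X. card (B x))" using x0 by (intro sum_mono) auto
  also have "\<dots> = card (\<Union>x\<in>X. B x)"
    using disj finX finB by (intro card_UN_disjoint[symmetric]) auto
  also have "\<dots> \<le> card (set_ball d S x0 (2 ^ k * \<rho>))"
    using sub S by (intro card_mono) (auto simp: set_ball_def)
  finally have "real (card X) * real (card (B x0)) \<le> real (card (set_ball d S x0 (2 ^ k * \<rho>)))"
    by (simp flip: of_nat_mult)
  also have "\<dots> \<le> expansion_constant d S ^ k * real (card (B x0))"
    unfolding B_def using expansion_constant_iterate[of S d x0 \<rho> k] S(1) zero' x0(1) X \<open>\<rho> > 0\<close> by auto
  finally show ?thesis using pos by simp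
qed

text \<open>A ball around \<open>a\<close> of radius less than the distance to \<open>S\<close> contains \<open>a\<close> alone.\<close>

lemma near_card_le:
  assumes S: "finite S" "S \<subseteq> M" "a \<in> M" and X: "X \<subseteq> S"
    and far: "\<And>x. x \<in> S \<Longrightarrow> \<delta> \<le> d a x" and "\<delta> > 0"
    and near: "\<And>x. x \<in> X \<Longrightarrow> d a x < 2 ^ k * \<delta>"
  shows "real (card X) \<le> expansion_constant d (insert a S) ^ k"
proof (cases "X = {}")
  case True
  have "expansion_constant d (insert a S) \<ge> 2"
    using S by (intro expansion_constant_props(1)) auto
  then show ?thesis using True by simp
next
  case False
  have finX: "finite X" using X S finite_subset by blast
  \<comment> \<open>Chosen so that the ball of radius \<open>2 ^ k * \<Delta>\<close> just reaches
    the farthest point of \<open>X\<close>; as \<open>X\<close> is finite, the strict bound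
    \<open>near\<close> gives \<open>\<Delta> < \<delta>\<close>.\<close>
  define \<Delta> where "\<Delta> = Max (d a ` X) / 2 ^ k"
  have Max: "Max (d a ` X) \<in> d a ` X" using finX False by (intro Max_in) auto
  then have lt: "\<Delta> < \<delta>" using near by (auto simp: \<Delta>_def field_simps)
  have "Max (d a ` X) \<ge> \<delta>" using Max far X by auto
  then have pos: "\<Delta> > 0" using \<open>\<delta> > 0\<close> by (simp add: \<Delta>_def)
  have "set_ball d (insert a S) a \<Delta> = {a}"
    using far lt pos S(3) by (auto simp: set_ball_def) (smt (verit))
  moreover have "d p p = 0" if "p \<in> insert a S" for p using that S by auto
  ultimately have
    "real (card (set_ball d (insert a S) a (2 ^ k * \<Delta>))) \<le> expansion_constant d (insert a S) ^ k"
    using expansion_constant_iterate[of "insert a S" d a \<Delta> k] S pos by simp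
  moreover have "card X \<le> card (set_ball d (insert a S) a (2 ^ k * \<Delta>))"
    using X S finX by (intro card_mono) (auto simp: set_ball_def \<Delta>_def)
  ultimately show ?thesis by linarith
qed

end

section \<open>Bounds on the reference sets of the traversal\<close>

lemma node_scale_le_max_scale: "N \<in> set R \<Longrightarrow> node_scale N \<le> max_scale R"
  by (auto simp: max_scale_def intro!: Max_ge)

lemma max_scale_attained: "max_scale R \<noteq> -\<infinity> \<Longrightarrow> \<exists>N\<in>set R. node_scale N = max_scale R"
proof -
  have "max_scale R \<in> insert (-\<infinity>) (node_scale ` set R)"
    unfolding max_scale_def by (rule Max_in) auto
  then show "max_scale R \<noteq> -\<infinity> \<Longrightarrow> \<exists>N\<in>set R. node_scale N = max_scale R" by force
qed

lemma max_scale_leI: "(\<And>N. N \<in> set R \<Longrightarrow> node_scale N \<le> m) \<Longrightarrow> max_scale R \<le> m"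
  by (auto simp: max_scale_def)

lemma max_scale_mono: "set R' \<subseteq> set R \<Longrightarrow> max_scale R' \<le> max_scale R"
  by (intro max_scale_leI node_scale_le_max_scale) auto

lemma radius_le: "node_scale N \<le> ereal (real_of_int m) \<Longrightarrow> radius N \<le> 2 powi (m + 1)"
  by (cases N) (auto intro: power_int_increasing)

text \<open>\<open>expand\<close> lists the children first; up to order it is the concatenation of
  these blocks, which suits induction over \<open>R\<close>.\<close>

definition expand_block :: "ereal \<Rightarrow> 'a ctree \<Rightarrow> 'a ctree list" where
  "expand_block m N = (if node_scale N = m then children N else [N])"

lemma mset_expand: "mset (expand R) = mset (concat (map (expand_block (max_scale R)) R))"
proof -
  have "mset (concat (map children (filter (\<lambda>N. node_scale N = m) R))
      @ filter (\<lambda>N. node_scale N \<noteq> m) R) = mset (concat (map (expand_block m) R))" for m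
    by (induction R) (auto simp: expand_block_def)
  then show ?thesis by (simp add: expand_def)
qed

lemma length_expand: "length (expand R) = (\<Sum>N\<leftarrow>R. length (expand_block (max_scale R) N))"
proof -
  have "length (expand R) = length (concat (map (expand_block (max_scale R)) R))"
    using mset_expand by (rule mset_eq_length)
  then show ?thesis by (simp add: length_concat comp_def)
qed

lemma set_expand: "c \<in> set (expand R) \<longleftrightarrow> (\<exists>N\<in>set R. c \<in> set (expand_block (max_scale R) N))"
  using mset_eq_setD[OF mset_expand[of R]] by simp

text \<open>\<open>f\<close> recovers the point of the block from any of its members, so different
  blocks share no point. It is applied with \<open>f\<close> a parent map.\<close>

lemma distinct_blocks:
  assumes "distinct (map point R)"
    and "\<And>N. N \<in> set R \<Longrightarrow> distinct (map point (B N))"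
    and "\<And>N c. N \<in> set R \<Longrightarrow> c \<in> set (B N) \<Longrightarrow> f (point c) = point N"
  shows "distinct (map point (concat (map B R)))"
  using assms
proof (induction R)
  case (Cons N R)
  have "distinct (map point (concat (map B R)))" using Cons by auto
  moreover have "point c \<noteq> point c'" if "c \<in> set (B N)" "N' \<in> set R" "c' \<in> set (B N')" for c c' N'
  proof -
    have "f (point c) = point N" "f (point c') = point N'" using that Cons.prems(3) by auto
    moreover have "point N \<noteq> point N'" using that(2) Cons.prems(1) by force
    ultimately show ?thesis by auto
  qed
  then have "set (map point (B N)) \<inter> set (map point (concat (map B R))) = {}"
    by (auto simp: disjoint_iff)
  ultimately show ?case using Cons.prems(2)[of N] by simp
qed simp

context cover_tree_levels
begin

text \<open>A node that is not expanded has scale at most \<open>s - 1\<close> and serves as its own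
  child, so both kinds of member lie at level \<open>s - 1\<close> and have the point of
  \<open>N\<close> as parent.\<close>

lemma expand_block_at_level:
  assumes N: "at_level t N" and "s \<le> t" and le: "node_scale N \<le> ereal (real_of_int s)"
    and c: "c \<in> set (expand_block (ereal (real_of_int s)) N)"
  shows "at_level (s - 1) c" "par s (point c) = point N"
    "c = N \<or> d (point c) (point N) < 2 powi s"
proof -
  have *: "at_level (s - 1) c \<and> par s (point c) = point N \<and> (c = N \<or> d (point c) (point N) < 2 powi s)"
  proof (cases "node_scale N = ereal (real_of_int s)")
    case True
    then obtain p ts where N_eq: "N = Node p s ts" by (cases N) auto
    note lev = at_level_Node[OF N[unfolded N_eq]]
    have "c \<in> set ts" using c N_eq by (simp add: expand_block_def)
    moreover from this have "point c \<in> implicit_children C par s p" using lev(4) by force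
    ultimately show ?thesis
      using lev(6) parent_dist[of "point c" s] N_eq by (auto simp: implicit_children_def)
  next
    case False
    then have c: "c = N" using c by (simp add: expand_block_def)
    have "node_scale N \<le> ereal (real_of_int (s - 1))"
      using False le by (cases N) auto
    then have "at_level (s - 1) N" using \<open>s \<le> t\<close> by (intro at_level_lower[OF N]) auto
    moreover have "point N \<in> C s" using at_level_lower[OF N le \<open>s \<le> t\<close>] at_level_point by blast
    ultimately show ?thesis using c parent_self by auto
  qed
  then show "at_level (s - 1) c" "par s (point c) = point N"
    "c = N \<or> d (point c) (point N) < 2 powi s" by auto
qed

end

context cover_tree_levels
begin

lemma expand_at_level:
  assumes R: "\<And>N. N \<in> set R \<Longrightarrow> at_level t N" "distinct (map point R)"
    and s: "max_scale R = ereal (real_of_int s)" "s \<le> t"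
  shows "c \<in> set (expand R) \<Longrightarrow> at_level (s - 1) c"
    and "distinct (map point (expand R))"
    and "c \<in> set (expand R) \<Longrightarrow>
      \<exists>N\<in>set R. c = N \<or> d (point c) (point N) < 2 powi s"
proof -
  have le: "node_scale N \<le> ereal (real_of_int s)" if "N \<in> set R" for N
    using node_scale_le_max_scale[OF that] s by simp
  note block = expand_block_at_level[OF R(1) s(2) le]
  show "at_level (s - 1) c" if "c \<in> set (expand R)"
    using that block(1) by (auto simp: set_expand s(1))
  show "\<exists>N\<in>set R. c = N \<or> d (point c) (point N) < 2 powi s"
    if c: "c \<in> set (expand R)"
  proof -
    obtain N where N: "N \<in> set R" "c \<in> set (expand_block (ereal (real_of_int s)) N)"
      using c by (auto simp: set_expand s(1))
    then show ?thesis using block(3)[OF N(1) N] by blast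
  qed
  have "distinct (map point (concat (map (expand_block (ereal (real_of_int s))) R)))"
  proof (rule distinct_blocks[OF R(2)])
    fix N assume N: "N \<in> set R"
    show "distinct (map point (expand_block (ereal (real_of_int s)) N))"
    proof (cases "node_scale N = ereal (real_of_int s)")
      case True
      then obtain p ts where "N = Node p s ts" by (cases N) auto
      then show ?thesis using at_level_Node(3)[of t p s ts] R(1)[OF N] by (simp add: expand_block_def)
    qed (simp add: expand_block_def)
    show "par s (point c) = point N" if "c \<in> set (expand_block (ereal (real_of_int s)) N)" for c
      using block(2)[OF N N that] .
  qed
  moreover have "mset (map point (expand R)) =
      mset (map point (concat (map (expand_block (ereal (real_of_int s))) R)))"
    using mset_expand[of R] s(1) by (metis mset_map)
  ultimately show "distinct (map point (expand R))"
    using mset_eq_imp_distinct_iff by blast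
qed

text \<open>Packing with balls of radius \<open>2 powi (t - 1)\<close>, half the separation of level
  \<open>t\<close>; two points of \<open>X\<close> are within \<open>2 * b\<close> of each other
  through \<open>a\<close>.\<close>

lemma level_card_le:
  assumes X: "X \<subseteq> C t" "\<And>x. x \<in> X \<Longrightarrow> d a x < b" "a \<in> M"
    and b: "2 * b + 2 powi (t - 1) \<le> 2 ^ k * 2 powi (t - 1)"
  shows "real (card X) \<le> expansion_constant d S ^ k"
proof (rule separated_card_le)
  show "finite S" "S \<subseteq> M" "X \<subseteq> S" using finite_S S_subset X(1) level_subset by auto
  show "(0::real) < 2 powi (t - 1)" by simp
  show "d x y > 2 * 2 powi (t - 1)" if "x \<in> X" "y \<in> X" "x \<noteq> y" for x y
    using that separated[of x t y] X(1) by (auto simp: power_int_diff)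
  show "d x y + 2 powi (t - 1) \<le> 2 ^ k * 2 powi (t - 1)" if "x \<in> X" "y \<in> X" for x y
  proof -
    have "d x y \<le> d x a + d a y"
      using that \<open>X \<subseteq> S\<close> S_subset X(3) by (intro triangle) auto
    also have "\<dots> \<le> 2 * b" using X(2)[OF that(1)] X(2)[OF that(2)] commute[of x a] by linarith
    finally show ?thesis using b by linarith
  qed
qed

lemma expansion_ge_2: "expansion_constant d S \<ge> 2"
  using S_subset by (intro expansion_constant_props(1) finite_S) auto

text \<open>In units of the packing radius \<open>2 powi (s - 2)\<close>, the requirement is
  \<open>2 * 4 + 1 \<le> 2 ^ 4\<close>.\<close>

lemma length_children_le:
  assumes "at_level t N"
  shows "real (length (children N)) \<le> expansion_constant d S ^ 4"
proof (cases N)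
  case (Leaf p)
  then show ?thesis using expansion_ge_2 by simp
next
  case (Node p s ts)
  note lev = at_level_Node[OF assms[unfolded Node]]
  have "real (card (implicit_children C par s p)) \<le> expansion_constant d S ^ 4"
  proof (rule level_card_le[of _ "s - 1" p "2 powi s"])
    show "p \<in> M" using lev(2) level_subset S_subset by blast
    show "d p x < 2 powi s" if "x \<in> implicit_children C par s p" for x
      using that parent_dist[of x s] by (auto simp: implicit_children_def commute)
    show "2 * 2 powi s + 2 powi (s - 1 - 1) \<le> 2 ^ 4 * (2 powi (s - 1 - 1) :: real)"
      by (simp add: power_int_diff)
  qed (auto simp: implicit_children_def)
  moreover have "card (implicit_children C par s p) = length ts"
    using lev(3,4) distinct_card[of "map point ts"] by simp
  ultimately show ?thesis by (simp add: Node)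
qed

lemma length_expand_le:
  assumes "\<And>N. N \<in> set R \<Longrightarrow> at_level t N"
  shows "real (length (expand R)) \<le> expansion_constant d S ^ 4 * real (length R)"
proof -
  have one: "1 \<le> expansion_constant d S ^ 4" using expansion_ge_2 by (intro one_le_power) simp
  have "real (\<Sum>N\<leftarrow>R. length (expand_block m N)) \<le> expansion_constant d S ^ 4 * real (length R)" for m
    using assms
  proof (induction R)
    case (Cons N R)
    have "real (length (expand_block m N)) \<le> expansion_constant d S ^ 4"
      using length_children_le[of t N] Cons.prems one by (auto simp: expand_block_def)
    then show ?case using Cons by (simp add: algebra_simps)
  qed simp
  then show ?thesis by (simp add: length_expand)
qed

end

section \<open>Nearest neighbor distances and the sizes of reference sets\<close>

definition nn_dist_to :: "('a \<Rightarrow> 'a \<Rightarrow> real) \<Rightarrow> 'a set \<Rightarrow> 'a \<Rightarrow> real" where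
  "nn_dist_to d S p = Min (d p ` S)"

locale nn_search = Metric_space M d +
  ref: cover_tree_levels M d Sr Cr parr rr + qry: cover_tree_levels M d Sq Cq parq rq
  for M :: "'a set" and d Sr Cr parr rr Sq Cq parq rq
begin

abbreviation nn :: "'a \<Rightarrow> real" where
  "nn \<equiv> nn_dist_to d Sr"

lemma ref_nonempty: "Sr \<noteq> {}"
  using ref.implicit ref.level_subset by (auto simp: implicit_cover_tree_def)

lemma nn_le: "r \<in> Sr \<Longrightarrow> nn p \<le> d p r"
  using ref.finite_S by (auto simp: nn_dist_to_def)

lemma nn_attained: "\<exists>r\<in>Sr. d p r = nn p"
proof -
  have "nn p \<in> d p ` Sr"
    unfolding nn_dist_to_def using ref.finite_S ref_nonempty by (intro Min_in) auto
  then show ?thesis by auto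
qed

lemma nn_nonneg: "nn p \<ge> 0"
  using nn_attained[of p] nonneg by metis

abbreviation c_ref :: real where
  "c_ref \<equiv> expansion_constant d Sr"

abbreviation c_max :: real where
  "c_max \<equiv> c_qr d Sq Sr"

text \<open>The factor of the theorem; it will bound the length of every reference set that occurs
  and of its expansion.\<close>

definition W :: real where
  "W = c_ref ^ 4 * c_max ^ 5"

lemma c_ref_le: "2 \<le> c_ref" "c_ref \<le> c_max"
  using ref.expansion_ge_2 by (auto simp: c_qr_def)

lemma c_query_le: "a \<in> Sq \<Longrightarrow> expansion_constant d (insert a Sr) \<le> c_max"
  using qry.finite_S by (auto simp: c_qr_def intro!: max.coboundedI1 Max_ge)

text \<open>As \<open>c_ref\<close> is at most \<open>c_max\<close>, packing in \<open>Sr\<close>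
  alone may use any exponent up to \<open>4 + 5\<close>.\<close>

lemma c_ref_power_le_W: "k \<le> 9 \<Longrightarrow> c_ref ^ k \<le> W"
proof -
  assume "k \<le> 9"
  then have "c_ref ^ k \<le> c_ref ^ 9" using c_ref_le by (intro power_increasing) auto
  also have "\<dots> = c_ref ^ 4 * c_ref ^ 5" by (simp flip: power_add)
  also have "\<dots> \<le> W" unfolding W_def using c_ref_le by (intro mult_left_mono power_mono) auto
  finally show ?thesis .
qed

lemma W_ge_1: "1 \<le> W"
  using c_ref_power_le_W[of 0] by simp

text \<open>
  What remains true of the reference set after a reference recursion at scale \<open>s\<close> with query
  point \<open>a\<close>, where \<open>E\<close> is the candidate distance of \<open>a\<close> used in pruning: the radius of the
  query node is at most \<open>2\<^bsup>s\<^esup>\<close>, and the parent of a reference node was compared with \<open>a\<close>.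
\<close>

definition anchored :: "'a \<Rightarrow> int \<Rightarrow> real \<Rightarrow> 'a ctree list \<Rightarrow> bool" where
  "anchored a s E R \<longleftrightarrow> a \<in> Sq \<and> distinct (map point R) \<and>
     (\<forall>N\<in>set R. ref.at_level (s - 1) N \<and> d a (point N) < E + 2 powi (s + 1) + radius N \<and>
        E \<le> d a (point N) + 2 powi s) \<and>
     (E \<le> nn a \<or> (\<exists>N\<in>set R. \<exists>q\<in>leaf_points N. d a q = nn a))"

text \<open>Two radii of at most \<open>2 powi (m + 1)\<close> enter: that of the node holding the
  nearest neighbor, which bounds \<open>E\<close>, and that of \<open>N\<close> in the pruning test.
  The terms \<open>2 powi s\<close> and \<open>2 powi (s + 1)\<close> of \<open>anchored\<close> add
  up to \<open>3 * 2 powi s\<close>.\<close>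

lemma anchored_dist:
  assumes R: "anchored a s E R" and m: "max_scale R \<le> ereal (real_of_int m)" and N: "N \<in> set R"
  shows "d a (point N) < nn a + 3 * 2 powi s + 2 powi (m + 2)"
proof -
  have rad: "radius N' \<le> 2 powi (m + 1)" if "N' \<in> set R" for N'
    by (intro radius_le order_trans[OF node_scale_le_max_scale[OF that] m])
  have "E \<le> nn a + 2 powi s + 2 powi (m + 1)"
  proof (cases "E \<le> nn a")
    case True
    moreover have "(0::real) \<le> 2 powi s + 2 powi (m + 1)" by simp
    ultimately show ?thesis by linarith
  next
    case False
    then obtain N' q where N': "N' \<in> set R" "q \<in> leaf_points N'" "d a q = nn a"
      using R by (auto simp: anchored_def)
    have lev: "ref.at_level (s - 1) N'" and E: "E \<le> d a (point N') + 2 powi s"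
      using R N' by (auto simp: anchored_def)
    have "d a (point N') \<le> d a q + d q (point N')"
      using R qry.S_subset ref.S_subset ref.leaf_points_subset[OF lev] ref.at_level_point_S[OF lev] N'(2)
      by (intro triangle) (auto simp: anchored_def)
    then show ?thesis using ref.radius_bound(1)[OF lev N'(2)] rad[OF N'(1)] N'(3) E by linarith
  qed
  moreover have "d a (point N) < E + 2 powi (s + 1) + radius N"
    using R N by (auto simp: anchored_def)
  ultimately show ?thesis using rad[OF N] by (simp add: power_int_add)
qed

text \<open>All scales are at most \<open>s - 1\<close>, so the distances are below
  \<open>nn a + 5 * 2 powi s \<le> 21 * nn a\<close>, and 21 is less than
  \<open>2 ^ 5\<close>.\<close>

lemma anchored_card_le_far:
  assumes R: "anchored a s E R" and far: "nn a \<ge> 2 powi s / 4"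
  shows "real (length R) \<le> c_max ^ 5"
proof -
  have a: "a \<in> Sq" and dist: "distinct (map point R)"
    and lev: "\<And>N. N \<in> set R \<Longrightarrow> ref.at_level (s - 1) N"
    using R by (auto simp: anchored_def)
  have m: "max_scale R \<le> ereal (real_of_int (s - 1))"
    using ref.at_level_scale lev by (intro max_scale_leI) blast
  have pos: "(0::real) < 2 powi s" by simp
  have "real (card (set (map point R))) \<le> expansion_constant d (insert a Sr) ^ 5"
  proof (rule near_card_le[where \<delta> = "nn a"])
    show "set (map point R) \<subseteq> Sr" using lev ref.at_level_point_S by auto
    show "a \<in> M" using a qry.S_subset by auto
    show "0 < nn a" using far pos by linarith
    show "d a x < 2 ^ 5 * nn a" if x: "x \<in> set (map point R)" for x
    proof -
      obtain N where "N \<in> set R" "x = point N" using x by auto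
      then have "d a x < nn a + 3 * 2 powi s + 2 powi (s - 1 + 2)"
        using anchored_dist[OF R m] by simp
      also have "\<dots> = nn a + 5 * 2 powi s" by (simp add: power_int_add)
      finally show ?thesis using far nn_nonneg[of a] by simp
    qed
  qed (use ref.finite_S ref.S_subset nn_le in auto)
  also have "\<dots> \<le> c_max ^ 5"
  proof (intro power_mono c_query_le[OF a])
    have "2 \<le> expansion_constant d (insert a Sr)"
      using a qry.S_subset ref.S_subset ref.finite_S by (intro expansion_constant_props(1)) auto
    then show "0 \<le> expansion_constant d (insert a Sr)" by simp
  qed
  finally show ?thesis using dist by (simp only: distinct_card length_map)
qed

lemma length_le_of_level:
  assumes "distinct (map point R)" "\<And>N. N \<in> set R \<Longrightarrow> ref.at_level t N"
    and "\<And>N. N \<in> set R \<Longrightarrow> d a (point N) < b" "a \<in> Sq"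
    and "2 * b + 2 powi (t - 1) \<le> 2 ^ k * 2 powi (t - 1)"
  shows "real (length R) \<le> c_ref ^ k"
proof -
  have "real (card (set (map point R))) \<le> c_ref ^ k"
    using assms ref.at_level_point qry.S_subset by (intro ref.level_card_le[of _ t a b]) auto
  then show ?thesis using assms(1) by (simp only: distinct_card length_map)
qed

lemma anchored_length_le:
  assumes R: "anchored a s E R"
  shows "real (length R) \<le> W"
proof (cases "nn a \<ge> 2 powi s / 4")
  case True
  have "1 * c_max ^ 5 \<le> W"
    unfolding W_def using c_ref_le by (intro mult_right_mono one_le_power zero_le_power) auto
  then show ?thesis using anchored_card_le_far[OF R True] by simp
next
  case False
  have lev: "\<And>N. N \<in> set R \<Longrightarrow> ref.at_level (s - 1) N"
    using R by (auto simp: anchored_def)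
  then have m: "max_scale R \<le> ereal (real_of_int (s - 1))"
    using ref.at_level_scale by (intro max_scale_leI) blast
  \<comment> \<open>The radius is \<open>1/4 + 5\<close> times \<open>2 powi s\<close>. In units of
    \<open>2 powi (s - 2)\<close> the requirement is \<open>42 + 1 \<le> 2 ^ 6\<close>.\<close>
  have "real (length R) \<le> c_ref ^ 6"
  proof (rule length_le_of_level[of R "s - 1" a "21 / 4 * 2 powi s"])
    show "distinct (map point R)" "a \<in> Sq" using R by (auto simp: anchored_def)
    show "d a (point N) < 21 / 4 * 2 powi s" if "N \<in> set R" for N
      using anchored_dist[OF R m that] False by (simp add: power_int_add power_int_diff)
  qed (use lev in \<open>simp_all add: power_int_diff\<close>)
  then show ?thesis using c_ref_power_le_W[of 6] by simp
qed

text \<open>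
  The bound is \<open>c_ref\<^sup>4\<close> times the length of \<open>R\<close> only if the query point is far or the
  expanded nodes are at least three scales below \<open>s\<close>, so that their radii do not matter;
  otherwise all children are counted at once.
\<close>

lemma anchored_expand_length_le:
  assumes R: "anchored a s E R" and nonleaf: "max_scale R \<noteq> -\<infinity>"
  shows "real (length (expand R)) \<le> W"
proof -
  have lev: "\<And>N. N \<in> set R \<Longrightarrow> ref.at_level (s - 1) N" and dist: "distinct (map point R)"
    and a: "a \<in> Sq" using R by (auto simp: anchored_def)
  obtain N0 where N0: "N0 \<in> set R" "node_scale N0 = max_scale R"
    using max_scale_attained[OF nonleaf] by blast
  then have "node_scale N0 \<noteq> -\<infinity>" using nonleaf by simp
  then obtain m where "node_scale N0 = ereal (real_of_int m)"
    by (cases N0) auto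
  then have m: "max_scale R = ereal (real_of_int m)" using N0(2) by simp
  have "m \<le> s - 1" using ref.at_level_scale[OF lev[OF N0(1)]] N0(2) m by simp
  note ex = ref.expand_at_level[OF lev dist m this]
  have ex_dist: "d a (point c) < nn a + 3 * 2 powi s + 2 powi (m + 2) + 2 powi m"
    if c: "c \<in> set (expand R)" for c
  proof -
    obtain N where N: "N \<in> set R" "c = N \<or> d (point c) (point N) < 2 powi m"
      using ex(3)[OF _ c] by blast
    have "d a (point c) \<le> d a (point N) + d (point N) (point c)"
      using a qry.S_subset ref.S_subset ref.at_level_point_S lev[OF N(1)] ref.at_level_point_S[OF ex(1)[OF _ c]]
      by (intro triangle) auto
    moreover have "d (point N) (point c) \<le> 2 powi m"
      using N(2) ref.at_level_point_S[OF lev[OF N(1)]] ref.S_subset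
      by (auto simp: commute subset_iff)
    ultimately show ?thesis using anchored_dist[OF R, of m] m N(1) by fastforce
  qed
  have mult: "real (length (expand R)) \<le> c_ref ^ 4 * real (length R)"
    using lev by (rule ref.length_expand_le)
  show ?thesis
  proof (cases "nn a \<ge> 2 powi s / 4")
    case True
    have "c_ref ^ 4 * real (length R) \<le> W"
      unfolding W_def using anchored_card_le_far[OF R True] c_ref_le by (intro mult_left_mono) auto
    then show ?thesis using mult by simp
  next
    case near: False
    consider "m = s - 1" | "m = s - 2" | "m \<le> s - 3" using \<open>m \<le> s - 1\<close> by linarith
    then show ?thesis
    proof cases
      case 1
      \<comment> \<open>The radius is \<open>1/4 + 3 + 2 + 1/2\<close> times
        \<open>2 powi s\<close>, the children lie at level \<open>s - 2\<close>, and
        \<open>92 + 1 \<le> 2 ^ 7\<close>.\<close>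
      have "real (length (expand R)) \<le> c_ref ^ 7"
      proof (rule length_le_of_level[of _ "m - 1" a "23 / 4 * 2 powi s"])
        show "d a (point N) < 23 / 4 * 2 powi s" if "N \<in> set (expand R)" for N
          using ex_dist[OF that] near 1 by (simp add: power_int_add power_int_diff)
      qed (use ex(1,2) a in \<open>simp_all add: 1 power_int_add power_int_diff\<close>)
      then show ?thesis using c_ref_power_le_W[of 7] by simp
    next
      case 2
      \<comment> \<open>Here the radius is \<open>1/4 + 3 + 1 + 1/4\<close> times
        \<open>2 powi s\<close>, the children lie at level \<open>s - 3\<close>, and
        \<open>144 + 1 \<le> 2 ^ 8\<close>.\<close>
      have "real (length (expand R)) \<le> c_ref ^ 8"
      proof (rule length_le_of_level[of _ "m - 1" a "9 / 2 * 2 powi s"])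
        show "d a (point N) < 9 / 2 * 2 powi s" if "N \<in> set (expand R)" for N
          using ex_dist[OF that] near 2 by (simp add: power_int_add power_int_diff)
      qed (use ex(1,2) a in \<open>simp_all add: 2 power_int_add power_int_diff\<close>)
      then show ?thesis using c_ref_power_le_W[of 8] by simp
    next
      case 3
      \<comment> \<open>Now \<open>R\<close> itself has radius \<open>1/4 + 3 + 1/2\<close> times
        \<open>2 powi s\<close> at level \<open>s - 1\<close>, and
        \<open>30 + 1 \<le> 2 ^ 5\<close>. The factor \<open>c_ref ^ 4\<close> for the children then
        brings the exponent to exactly 9.\<close>
      have "(2::real) powi (m + 2) \<le> 2 powi (s - 1)" using 3 by (intro power_int_increasing) auto
      then have "d a (point N) < 15 / 4 * 2 powi s" if "N \<in> set R" for N
        using anchored_dist[OF R, of m] m that near by (force simp: power_int_diff)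
      then have "real (length R) \<le> c_ref ^ 5"
        using a dist lev
        by (intro length_le_of_level[of R "s - 1" a "15 / 4 * 2 powi s"]) (simp_all add: power_int_diff)
      then have "c_ref ^ 4 * real (length R) \<le> c_ref ^ 4 * c_ref ^ 5"
        using c_ref_le by (intro mult_left_mono) auto
      then show ?thesis using mult c_ref_power_le_W[of 9] by (simp flip: power_add)
    qed
  qed
qed

end

section \<open>The traversal\<close>

text \<open>
  An upper bound on the number of recursive calls in the subtree of a query node entered with
  reference nodes of scale at most \<open>m\<close>, if all reference scales are in \<open>SC\<close>: every reference
  recursion lowers the maximal reference scale.
\<close>

fun calls :: "int set \<Rightarrow> ereal \<Rightarrow> 'a ctree \<Rightarrow> nat" where
  "calls SC m (Leaf p) = card {\<sigma>\<in>SC. ereal (real_of_int \<sigma>) \<le> m} + 1"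
| "calls SC m (Node p s ts) = card {\<sigma>\<in>SC. s < \<sigma> \<and> ereal (real_of_int \<sigma>) \<le> m} + 1
     + (\<Sum>t\<leftarrow>ts. calls SC (ereal (real_of_int s)) t)"

lemma calls_eq:
  "calls SC m N = card {\<sigma>\<in>SC. node_scale N < ereal (real_of_int \<sigma>) \<and> ereal (real_of_int \<sigma>) \<le> m} + 1
     + (\<Sum>t\<leftarrow>children N. calls SC (node_scale N) t)"
  by (cases N) auto

lemma calls_mono:
  assumes "finite SC" "m \<le> m'"
  shows "calls SC m N \<le> calls SC m' N"
proof -
  have "card {\<sigma>\<in>SC. node_scale N < ereal (real_of_int \<sigma>) \<and> ereal (real_of_int \<sigma>) \<le> m}
      \<le> card {\<sigma>\<in>SC. node_scale N < ereal (real_of_int \<sigma>) \<and> ereal (real_of_int \<sigma>) \<le> m'}"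
    using assms by (intro card_mono) (auto intro: order_trans[OF _ assms(2)])
  then show ?thesis by (simp add: calls_eq[of SC _ N])
qed

text \<open>The scale \<open>s\<close> itself is counted on the right but not on the left.\<close>

lemma calls_less:
  assumes "finite SC" "m < ereal (real_of_int s)" "s \<in> SC" "node_scale N < ereal (real_of_int s)"
  shows "calls SC m N < calls SC (ereal (real_of_int s)) N"
proof -
  have "card {\<sigma>\<in>SC. node_scale N < ereal (real_of_int \<sigma>) \<and> ereal (real_of_int \<sigma>) \<le> m}
      < card {\<sigma>\<in>SC. node_scale N < ereal (real_of_int \<sigma>) \<and> ereal (real_of_int \<sigma>) \<le> ereal (real_of_int s)}"
  proof (rule psubset_card_mono)
    have "s \<notin> {\<sigma>\<in>SC. node_scale N < ereal (real_of_int \<sigma>) \<and> ereal (real_of_int \<sigma>) \<le> m}"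
      using assms(2) by auto
    moreover have "s \<in> {\<sigma>\<in>SC. node_scale N < ereal (real_of_int \<sigma>) \<and> ereal (real_of_int \<sigma>) \<le> ereal (real_of_int s)}"
      using assms by auto
    moreover have "ereal (real_of_int \<sigma>) \<le> ereal (real_of_int s)" if "ereal (real_of_int \<sigma>) \<le> m" for \<sigma>
      using order_trans[OF that less_imp_le[OF assms(2)]] .
    ultimately show "{\<sigma>\<in>SC. node_scale N < ereal (real_of_int \<sigma>) \<and> ereal (real_of_int \<sigma>) \<le> m}
        \<subset> {\<sigma>\<in>SC. node_scale N < ereal (real_of_int \<sigma>) \<and> ereal (real_of_int \<sigma>) \<le> ereal (real_of_int s)}"
      by blast
  qed (use assms(1) in simp)
  then show ?thesis by (simp add: calls_eq[of SC _ N])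
qed

lemma leaf_points_expand:
  assumes "N \<in> set R" "q \<in> leaf_points N"
    and "max_scale R \<noteq> -\<infinity>"
  shows "\<exists>c\<in>set (expand R). q \<in> leaf_points c"
proof -
  have "\<exists>c\<in>set (expand_block (max_scale R) N). q \<in> leaf_points c"
  proof (cases "node_scale N = max_scale R")
    case True
    then have "node_scale N \<noteq> -\<infinity>" using assms(3) by simp
    then show ?thesis using assms(2) True by (cases N) (simp_all add: expand_block_def)
  qed (use assms(2) in \<open>simp add: expand_block_def\<close>)
  then show ?thesis using assms(1) set_expand[of _ R] by blast
qed

lemma nonleaf_scales_expand:
  assumes "\<And>N. N \<in> set R \<Longrightarrow> nonleaf_scales N \<subseteq> SC" "c \<in> set (expand R)"
  shows "nonleaf_scales c \<subseteq> SC"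
proof -
  obtain N where N: "N \<in> set R" "c \<in> set (expand_block (max_scale R) N)"
    using assms(2) by (auto simp: set_expand)
  have "nonleaf_scales c \<subseteq> nonleaf_scales N"
    using N(2) by (cases N) (auto simp: expand_block_def split: if_splits)
  then show ?thesis using assms(1)[OF N(1)] by blast
qed

section \<open>States of the search and the invariant of the traversal\<close>

context nn_search
begin

text \<open>By the second conjunct a repeated pair could not improve the candidate anyway, so
  \<open>nn_base_case\<close> always replaces the distance by a minimum.\<close>

definition consistent :: "'a nn_state \<Rightarrow> bool" where
  "consistent st \<longleftrightarrow> (\<forall>p. nn_dist st p = \<infinity> \<or> (\<exists>r\<in>Sr. nn_dist st p = ereal (d p r))) \<and>
     (\<forall>(p, r)\<in>nn_called st. nn_dist st p \<le> ereal (d p r))"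

text \<open>Besides expressing correctness, this yields the last conjunct of \<open>anchored\<close>
  and so the bound on \<open>E\<close> in \<open>anchored_dist\<close>.\<close>

definition covered :: "'a nn_state \<Rightarrow> 'a ctree list \<Rightarrow> 'a \<Rightarrow> bool" where
  "covered st R p \<longleftrightarrow>
     nn_dist st p \<le> ereal (nn p) \<or> (\<exists>N\<in>set R. \<exists>q\<in>leaf_points N. d p q = nn p)"

lemma base_case_props:
  fixes p :: 'a
  assumes "consistent st" "r \<in> Sr"
  defines "st' \<equiv> nn_base_case d p r st"
  shows "consistent st'" "nn_dist st' p \<le> ereal (d p r)" "nn_dist st' x \<le> nn_dist st x"
    "x \<noteq> p \<Longrightarrow> nn_dist st' x = nn_dist st x"
proof -
  have le: "nn_dist st p \<le> ereal (d p r)" if "(p, r) \<in> nn_called st"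
    using assms(1) that by (auto simp: consistent_def)
  have dist: "nn_dist st' = (nn_dist st)(p := min (nn_dist st p) (ereal (d p r)))"
    using le by (auto simp: st'_def nn_base_case_def Let_def min_def)
  have called: "nn_called st' = insert (p, r) (nn_called st)"
    by (auto simp: st'_def nn_base_case_def Let_def)
  have "nn_dist st' y = \<infinity> \<or> (\<exists>r\<in>Sr. nn_dist st' y = ereal (d y r))" for y
    using assms(1,2) by (auto simp: consistent_def dist min_def)
  moreover have "nn_dist st' y \<le> ereal (d y z)" if "(y, z) \<in> nn_called st'" for y z
  proof -
    have "nn_dist st y \<le> ereal (d y z)" if "(y, z) \<in> nn_called st"
      using assms(1) that by (auto simp: consistent_def)
    then show ?thesis using that by (auto simp: dist called min_le_iff_disj)
  qed
  ultimately show "consistent st'" by (auto simp: consistent_def)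
  show "nn_dist st' p \<le> ereal (d p r)" "nn_dist st' x \<le> nn_dist st x"
    "x \<noteq> p \<Longrightarrow> nn_dist st' x = nn_dist st x"
    by (auto simp: dist)
qed

lemma fold_base_case_props:
  fixes p :: 'a
  assumes "consistent st" "\<And>N. N \<in> set R \<Longrightarrow> point N \<in> Sr"
  defines "st' \<equiv> fold (\<lambda>Nr. nn_base_case d p (point Nr)) R st"
  shows "consistent st'" "N \<in> set R \<Longrightarrow> nn_dist st' p \<le> ereal (d p (point N))"
    "nn_dist st' x \<le> nn_dist st x" "x \<noteq> p \<Longrightarrow> nn_dist st' x = nn_dist st x"
proof -
  have "consistent (fold (\<lambda>Nr. nn_base_case d p (point Nr)) R st) \<and>
    (\<forall>N\<in>set R. nn_dist (fold (\<lambda>Nr. nn_base_case d p (point Nr)) R st) p \<le> ereal (d p (point N))) \<and>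
    (\<forall>x. nn_dist (fold (\<lambda>Nr. nn_base_case d p (point Nr)) R st) x \<le> nn_dist st x) \<and>
    (\<forall>x. x \<noteq> p \<longrightarrow> nn_dist (fold (\<lambda>Nr. nn_base_case d p (point Nr)) R st) x = nn_dist st x)"
    using assms(1,2)
  proof (induction R arbitrary: st)
    case (Cons N R)
    have N: "point N \<in> Sr" using Cons.prems(2) by simp
    note b = base_case_props[OF Cons.prems(1) N]
    have R: "\<And>N. N \<in> set R \<Longrightarrow> point N \<in> Sr" using Cons.prems(2) by simp
    note IH = Cons.IH[OF b(1)[of p] R]
    have "nn_dist (fold (\<lambda>Nr. nn_base_case d p (point Nr)) R (nn_base_case d p (point N) st)) p
        \<le> ereal (d p (point N))"
      using IH b(2)[of p] order_trans by blast
    moreover have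
      "nn_dist (fold (\<lambda>Nr. nn_base_case d p (point Nr)) R (nn_base_case d p (point N) st)) x
        \<le> nn_dist st x" for x
      using IH b(3)[of p x] order_trans by blast
    ultimately show ?case using IH b(4)[of _ p] by simp
  qed simp
  then show "consistent st'" "N \<in> set R \<Longrightarrow> nn_dist st' p \<le> ereal (d p (point N))"
    "nn_dist st' x \<le> nn_dist st x" "x \<noteq> p \<Longrightarrow> nn_dist st' x = nn_dist st x"
    by (auto simp: st'_def)
qed

text \<open>A pair containing a nearest neighbor of \<open>p\<close> can be pruned only by a tie
  between two leaves, and then the candidate of \<open>p\<close> is already optimal.\<close>

lemma pruned_done:
  assumes st: "consistent st" and Nq: "qry.at_level u Nq" and N: "ref.at_level t N"
    and prune: "nn_score d st Nq N = \<infinity>" and p: "p \<in> leaf_points Nq"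
    and q: "q \<in> leaf_points N" "d p q = nn p"
  shows "nn_dist st p \<le> ereal (nn p)"
proof -
  have "\<not> ereal (d_min d Nq N) < nn_bound st Nq"
    using prune by (auto simp: nn_score_def split: if_splits)
  then have le: "nn_dist st (point Nq) + ereal (radius Nq) \<le> ereal (d_min d Nq N)"
    by (simp add: nn_bound_def)
  then have "nn_dist st (point Nq) \<noteq> \<infinity>" by auto
  then obtain r where r: "r \<in> Sr" "nn_dist st (point Nq) = ereal (d (point Nq) r)"
    using st by (auto simp: consistent_def)
  have M: "p \<in> M" "q \<in> M" "point Nq \<in> M" "point N \<in> M" "r \<in> M"
    using p q qry.leaf_points_subset[OF Nq] ref.leaf_points_subset[OF N] qry.S_subset ref.S_subset
      qry.at_level_point_S[OF Nq] ref.at_level_point_S[OF N] r(1) by auto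
  have 1: "d (point Nq) r + radius Nq \<le> d (point Nq) (point N) - radius Nq - radius N"
    using le r(2) by (simp add: d_min_def)
  have 2: "d (point Nq) (point N) \<le> d p (point Nq) + nn p + d q (point N)"
    using triangle[OF M(3,1,4)] triangle[OF M(1,2,4)] q(2) commute[of p "point Nq"] by linarith
  have 3: "nn p \<le> d p (point Nq) + d (point Nq) r"
    using nn_le[OF r(1), of p] triangle[OF M(1,3,5)] by linarith
  note rq = qry.radius_bound[OF Nq p] and rr = ref.radius_bound[OF N q(1)]
  \<comment> \<open>Facts 1 to 3 combine to \<open>2 * radius Nq + radius N \<le> 2 * d p (point Nq)
    + d q (point N)\<close>, which fails if either radius bound is strict.\<close>
  have "children Nq = []" "children N = []"
    using 1 2 3 rq rr by force+
  then obtain p' where "Nq = Leaf p'"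
    using qry.two_children[of u] Nq by (cases Nq) force+
  then show ?thesis using p r(2) 1 2 rq(1) rr(1) by simp
qed

text \<open>The clause \<open>length R \<le> 1\<close> admits the initial call. The anchor may be
  the point of an earlier query node: a child with a new point has infinite candidate distance,
  prunes nothing and inherits the set unchanged.\<close>

definition invariant :: "int set \<Rightarrow> int \<Rightarrow> int \<Rightarrow> 'a ctree \<Rightarrow> 'a ctree list \<Rightarrow> 'a nn_state \<Rightarrow> bool" where
  "invariant SC u t Nq R st \<longleftrightarrow> qry.at_level u Nq \<and> (\<forall>N\<in>set R. ref.at_level t N) \<and>
     distinct (map point R) \<and> (\<forall>N\<in>set R. nonleaf_scales N \<subseteq> SC) \<and> consistent st \<and>
     (\<forall>p\<in>leaf_points Nq. covered st R p) \<and>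
     (\<forall>p\<in>leaf_points Nq. p \<noteq> point Nq \<longrightarrow> nn_dist st p = \<infinity>) \<and>
     (length R \<le> 1 \<or> (\<exists>a s E. anchored a s E R \<and>
        (nn_dist st (point Nq) = \<infinity> \<or> point Nq = a \<and> nn_dist st a = ereal E)))"

lemma invariant_length_le:
  assumes "invariant SC u t Nq R st"
  shows "real (length R) \<le> W" "max_scale R \<noteq> -\<infinity> \<Longrightarrow> real (length (expand R)) \<le> W"
proof -
  have lev: "\<And>N. N \<in> set R \<Longrightarrow> ref.at_level t N" using assms by (auto simp: invariant_def)
  consider "length R \<le> 1" | a s E where "anchored a s E R"
    using assms by (auto simp: invariant_def)
  then have "real (length R) \<le> W \<and> (max_scale R \<noteq> -\<infinity> \<longrightarrow> real (length (expand R)) \<le> W)"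
  proof cases
    case 1
    have "real (length (expand R)) \<le> c_ref ^ 4 * real (length R)"
      using lev by (rule ref.length_expand_le)
    also have "\<dots> \<le> c_ref ^ 4 * 1"
      using 1 c_ref_le by (intro mult_left_mono) auto
    finally show ?thesis using 1 W_ge_1 c_ref_power_le_W[of 4] by simp
  next
    case 2
    then show ?thesis using anchored_length_le anchored_expand_length_le by blast
  qed
  then show "real (length R) \<le> W" "max_scale R \<noteq> -\<infinity> \<Longrightarrow> real (length (expand R)) \<le> W" by auto
qed

text \<open>Whatever the old anchor was, the base cases and the pruning anchor the new set at
  \<open>point Nq\<close> and scale \<open>s\<close>.\<close>

lemma reference_step:
  assumes inv: "invariant SC u t Nq R st" and less: "node_scale Nq < max_scale R"
  defines "st1 \<equiv> fold (\<lambda>Nr. nn_base_case d (point Nq) (point Nr)) R st"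
  defines "R' \<equiv> filter (\<lambda>Nr. nn_score d st1 Nq Nr \<noteq> \<infinity>) (expand R)"
  obtains s where "s \<in> SC" "max_scale R = ereal (real_of_int s)"
    "invariant SC u (s - 1) Nq R' st1" "max_scale R' < max_scale R"
proof -
  have Nq: "qry.at_level u Nq" and lev: "\<And>N. N \<in> set R \<Longrightarrow> ref.at_level t N"
    and dist: "distinct (map point R)" and SC: "\<And>N. N \<in> set R \<Longrightarrow> nonleaf_scales N \<subseteq> SC"
    and st: "consistent st" and cov: "\<And>p. p \<in> leaf_points Nq \<Longrightarrow> covered st R p"
    and inf: "\<And>p. p \<in> leaf_points Nq \<Longrightarrow> p \<noteq> point Nq \<Longrightarrow> nn_dist st p = \<infinity>"
    using inv by (auto simp: invariant_def)
  have nonleaf: "max_scale R \<noteq> -\<infinity>" using less by auto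
  obtain N0 where N0: "N0 \<in> set R" "node_scale N0 = max_scale R"
    using max_scale_attained[OF nonleaf] by blast
  then have "node_scale N0 \<noteq> -\<infinity>" using nonleaf by simp
  then obtain p0 s ts where N0_eq: "N0 = Node p0 s ts" by (cases N0) auto
  have s: "max_scale R = ereal (real_of_int s)" using N0(2) N0_eq by simp
  have "s \<in> SC" using SC[OF N0(1)] N0_eq by auto
  have "s \<le> t" using ref.at_level_scale[OF lev[OF N0(1)]] N0_eq by simp
  note ex = ref.expand_at_level[OF lev dist s \<open>s \<le> t\<close>]
  have R_Sr: "\<And>N. N \<in> set R \<Longrightarrow> point N \<in> Sr" using lev ref.at_level_point_S by blast
  have st1: "consistent st1" "\<And>N. N \<in> set R \<Longrightarrow> nn_dist st1 (point Nq) \<le> ereal (d (point Nq) (point N))"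
    "\<And>x. nn_dist st1 x \<le> nn_dist st x" "\<And>x. x \<noteq> point Nq \<Longrightarrow> nn_dist st1 x = nn_dist st x"
    unfolding st1_def by (intro fold_base_case_props st R_Sr; assumption)+
  have cov1: "covered st1 R' p" if p: "p \<in> leaf_points Nq" for p
  proof (cases "nn_dist st p \<le> ereal (nn p)")
    case True
    then show ?thesis using st1(3)[of p] order_trans by (auto simp: covered_def)
  next
    case False
    then obtain N q where N: "N \<in> set R" "q \<in> leaf_points N" "d p q = nn p"
      using cov[OF p] by (auto simp: covered_def)
    obtain c where c: "c \<in> set (expand R)" "q \<in> leaf_points c"
      using leaf_points_expand[OF N(1,2)] nonleaf by blast
    show ?thesis
    proof (cases "nn_score d st1 Nq c = \<infinity>")
      case True
      then show ?thesis
        using pruned_done[OF st1(1) Nq ex(1)[OF _ c(1)] True p c(2) N(3)] by (auto simp: covered_def)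
    next
      case False
      then show ?thesis using c N(3) by (auto simp: covered_def R'_def)
    qed
  qed
  \<comment> \<open>Finite because \<open>N0\<close> has just been compared with the query
    point.\<close>
  obtain E where E: "nn_dist st1 (point Nq) = ereal E"
    using st1(1) st1(2)[OF N0(1)] by (force simp: consistent_def)
  have E_le: "E \<le> d (point Nq) (point N)" if "N \<in> set R" for N
    using st1(2)[OF that] E by simp
  have M: "point Nq \<in> M" using qry.at_level_point_S[OF Nq] qry.S_subset by blast
  \<comment> \<open>The query node lies strictly below scale \<open>s\<close>, hence at scale
    \<open>s - 1\<close> or lower.\<close>
  have rad: "radius Nq \<le> 2 powi s"
    using radius_le[of Nq "s - 1"] less s by (cases Nq) auto
  have "anchored (point Nq) s E R'"
    unfolding anchored_def
  proof (intro conjI ballI)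
    show "point Nq \<in> Sq" using qry.at_level_point_S[OF Nq] .
    show "distinct (map point R')" using ex(2) by (simp add: R'_def distinct_map_filter)
    have "covered st1 R' (point Nq)" using cov1 qry.point_in_leaf_points[OF Nq] by blast
    then show "E \<le> nn (point Nq) \<or> (\<exists>N\<in>set R'. \<exists>q\<in>leaf_points N. d (point Nq) q = nn (point Nq))"
      by (simp add: covered_def E)
    fix c assume "c \<in> set R'"
    then have c: "c \<in> set (expand R)" "nn_score d st1 Nq c \<noteq> \<infinity>" by (auto simp: R'_def)
    show lev_c: "ref.at_level (s - 1) c" using ex(1)[OF _ c(1)] by simp
    have "ereal (d_min d Nq c) < ereal E + ereal (radius Nq)"
      using c(2) by (auto simp: nn_score_def nn_bound_def E split: if_splits)
    \<comment> \<open>One \<open>radius Nq\<close> comes from \<open>d_min\<close>, the other from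
      \<open>nn_bound\<close>.\<close>
    then have "d (point Nq) (point c) < E + 2 * radius Nq + radius c" by (simp add: d_min_def)
    then show "d (point Nq) (point c) < E + 2 powi (s + 1) + radius c"
      using rad by (simp add: power_int_add)
    obtain N where N: "N \<in> set R" "c = N \<or> d (point c) (point N) < 2 powi s"
      using ex(3)[OF _ c(1)] by blast
    show "E \<le> d (point Nq) (point c) + 2 powi s"
    proof (cases "c = N")
      case True
      then show ?thesis using E_le[OF N(1)] by (simp add: add_increasing2)
    next
      case False
      have "d (point Nq) (point N) \<le> d (point Nq) (point c) + d (point c) (point N)"
        using M ref.at_level_point_S[OF lev_c] ref.at_level_point_S[OF lev[OF N(1)]] ref.S_subset
        by (intro triangle) auto
      then show ?thesis using False N(2) E_le[OF N(1)] by simp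
    qed
  qed
  moreover have "distinct (map point R')" using ex(2) by (simp add: R'_def distinct_map_filter)
  moreover have "nonleaf_scales c \<subseteq> SC" if "c \<in> set R'" for c
    using nonleaf_scales_expand[of R SC c] SC that by (auto simp: R'_def)
  moreover have "nn_dist st1 p = \<infinity>" if "p \<in> leaf_points Nq" "p \<noteq> point Nq" for p
    using inf[OF that] st1(4)[OF that(2)] by simp
  moreover have lev': "ref.at_level (s - 1) c" if "c \<in> set R'" for c
    using ex(1)[of c] that by (auto simp: R'_def)
  ultimately have "invariant SC u (s - 1) Nq R' st1"
    unfolding invariant_def using Nq st1(1) cov1 E by blast
  moreover have "max_scale R' \<le> ereal (real_of_int (s - 1))"
    using lev' ref.at_level_scale by (intro max_scale_leI) blast
  then have "max_scale R' < max_scale R"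
    unfolding s by (rule order.strict_trans1) simp
  ultimately show ?thesis using that \<open>s \<in> SC\<close> s by blast
qed

text \<open>\<open>st'\<close> is the state after earlier siblings, which agrees with
  \<open>st\<close> on the leaf points of \<open>c\<close>. Either \<open>c\<close> has an unvisited
  point and prunes nothing, or it is the self-child and keeps the anchor point.\<close>

lemma query_step:
  assumes inv: "invariant SC u t Nq R st" and Nq_eq: "Nq = Node pq sq ts" and c: "c \<in> set ts"
    and st': "consistent st'" "\<And>p. p \<in> leaf_points c \<Longrightarrow> nn_dist st' p = nn_dist st p"
  defines "R' \<equiv> filter (\<lambda>Nr. nn_score d st' c Nr \<noteq> \<infinity>) R"
  shows "invariant SC (sq - 1) t c R' st'"
proof -
  have Nq: "qry.at_level u Nq" and lev: "\<And>N. N \<in> set R \<Longrightarrow> ref.at_level t N"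
    and dist: "distinct (map point R)" and SC: "\<And>N. N \<in> set R \<Longrightarrow> nonleaf_scales N \<subseteq> SC"
    and cov: "\<And>p. p \<in> leaf_points Nq \<Longrightarrow> covered st R p"
    and inf: "\<And>p. p \<in> leaf_points Nq \<Longrightarrow> p \<noteq> pq \<Longrightarrow> nn_dist st p = \<infinity>"
    using inv Nq_eq by (auto simp: invariant_def)
  note levq = qry.at_level_Node[OF Nq[unfolded Nq_eq]]
  have lev_c: "qry.at_level (sq - 1) c" using levq(6) c .
  have sub: "leaf_points c \<subseteq> leaf_points Nq" using c Nq_eq by auto
  have pc: "point c \<in> leaf_points c" using qry.point_in_leaf_points[OF lev_c] .
  have cov': "covered st' R' p" if p: "p \<in> leaf_points c" for p
  proof (cases "nn_dist st p \<le> ereal (nn p)")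
    case True
    then show ?thesis using st'(2)[OF p] by (simp add: covered_def)
  next
    case False
    then obtain N q where N: "N \<in> set R" "q \<in> leaf_points N" "d p q = nn p"
      using cov[of p] p sub by (auto simp: covered_def)
    show ?thesis
    proof (cases "nn_score d st' c N = \<infinity>")
      case True
      then show ?thesis
        using pruned_done[OF st'(1) lev_c lev[OF N(1)] True p N(2,3)] by (auto simp: covered_def)
    next
      case False
      then show ?thesis using N by (auto simp: covered_def R'_def)
    qed
  qed
  have inf': "nn_dist st' p = \<infinity>" if p: "p \<in> leaf_points c" "p \<noteq> point c" for p
  proof -
    \<comment> \<open>\<open>pq\<close> persists at level \<open>sq - 1\<close>, where
      \<open>point c\<close> is the only leaf point of \<open>c\<close>.\<close>
    have "p \<noteq> pq" using qry.leaf_points_level[OF lev_c p(1)] p(2) qry.nested[OF levq(2)] by auto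
    then show ?thesis using inf[of p] p(1) sub st'(2)[OF p(1)] by auto
  qed
  have "length R' \<le> 1 \<or> (\<exists>a s E. anchored a s E R' \<and>
        (nn_dist st' (point c) = \<infinity> \<or> point c = a \<and> nn_dist st' a = ereal E))"
  proof (cases "length R \<le> 1")
    case True
    then have "length R' \<le> 1" unfolding R'_def using length_filter_le le_trans by blast
    then show ?thesis by blast
  next
    case False
    then obtain a s E where a: "anchored a s E R"
      "nn_dist st pq = \<infinity> \<or> pq = a \<and> nn_dist st a = ereal E"
      using inv Nq_eq by (auto simp: invariant_def)
    show ?thesis
    proof (cases "nn_dist st' (point c) = \<infinity>")
      case True
      then have "nn_score d st' c N \<noteq> \<infinity>" for N by (simp add: nn_score_def nn_bound_def)
      then have "R' = R" by (simp add: R'_def)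
      then show ?thesis using True a(1) by blast
    next
      case noninf: False
      then have "nn_dist st (point c) \<noteq> \<infinity>" using st'(2)[OF pc] by simp
      then have "point c = pq" using inf[of "point c"] pc sub by auto
      then have E: "point c = a" "nn_dist st' a = ereal E"
        using a(2) noninf st'(2)[OF pc] by auto
      then have "covered st' R' a" using cov'[OF pc] by simp
      then have "E \<le> nn a \<or> (\<exists>N\<in>set R'. \<exists>q\<in>leaf_points N. d a q = nn a)"
        by (simp add: covered_def E)
      then have "anchored a s E R'"
        using a(1) by (auto simp: anchored_def R'_def distinct_map_filter)
      then show ?thesis using E by blast
    qed
  qed
  then show ?thesis
    unfolding invariant_def using lev_c lev dist SC st'(1) cov' inf'
    by (auto simp: R'_def distinct_map_filter)
qed

end

section \<open>Running time of the traversal\<close>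

context nn_search
begin

abbreviation nn_traverse :: "'a ctree \<Rightarrow> 'a ctree list \<Rightarrow> 'a nn_state \<Rightarrow> 'a nn_state \<times> nat" where
  "nn_traverse \<equiv> traverse (nn_base_case d) (nn_score d)"

definition child_step :: "'a ctree list \<Rightarrow> 'a ctree \<Rightarrow> 'a nn_state \<times> nat \<Rightarrow> 'a nn_state \<times> nat" where
  "child_step R = (\<lambda>c (st, T). let R' = filter (\<lambda>Nr. nn_score d st c Nr \<noteq> \<infinity>) R;
     (st', T') = nn_traverse c R' st in (st', T + length R + T'))"

lemma traverse_reference:
  fixes st :: "'a nn_state"
  assumes "node_scale Nq < max_scale R"
  defines "st1 \<equiv> fold (\<lambda>Nr. nn_base_case d (point Nq) (point Nr)) R st"
  defines "R' \<equiv> filter (\<lambda>Nr. nn_score d st1 Nq Nr \<noteq> \<infinity>) (expand R)"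
  shows "nn_traverse Nq R st =
    (fst (nn_traverse Nq R' st1),
     1 + 3 * length R + length (expand R) + snd (nn_traverse Nq R' st1))"
  using assms(1)
  by (subst traverse.simps) (simp add: Let_def case_prod_unfold flip: st1_def R'_def)

lemma traverse_query:
  assumes "\<not> node_scale Nq < max_scale R"
  shows "nn_traverse Nq R st = fold (child_step R) (children Nq) (st, 1 + length R)"
  using assms by (subst traverse.simps) (simp add: child_step_def)

text \<open>The slack \<open>W\<close> in the time pays for the scores of the query node in its parent's call.\<close>

definition traverse_post :: "int set \<Rightarrow> 'a ctree \<Rightarrow> 'a ctree list \<Rightarrow> 'a nn_state \<Rightarrow> bool" where
  "traverse_post SC Nq R st \<longleftrightarrow> consistent (fst (nn_traverse Nq R st)) \<and>
     (\<forall>p. p \<notin> leaf_points Nq \<longrightarrow> nn_dist (fst (nn_traverse Nq R st)) p = nn_dist st p) \<and>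
     real (snd (nn_traverse Nq R st)) + W \<le> 6 * W * real (calls SC (max_scale R) Nq)"

text \<open>Siblings have disjoint leaf points, so traversing one of them leaves the candidates of
  the others unchanged; hence the last hypothesis may be restricted to states agreeing with
  \<open>st\<close> on the leaf points of \<open>c\<close>.\<close>

lemma fold_child_step:
  assumes "finite SC" "real (length R) \<le> W" "max_scale R \<le> m"
    and "consistent st" "distinct (map point cs)" "\<And>c. c \<in> set cs \<Longrightarrow> qry.at_level u c"
    and "\<And>c st'. c \<in> set cs \<Longrightarrow> consistent st' \<Longrightarrow> (\<And>p. p \<in> leaf_points c \<Longrightarrow> nn_dist st' p = nn_dist st p) \<Longrightarrow>
      traverse_post SC c (filter (\<lambda>Nr. nn_score d st' c Nr \<noteq> \<infinity>) R) st'"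
  shows "consistent (fst (fold (child_step R) cs (st, T)))
     \<and> (\<forall>p. (\<forall>c\<in>set cs. p \<notin> leaf_points c) \<longrightarrow>
          nn_dist (fst (fold (child_step R) cs (st, T))) p = nn_dist st p)
     \<and> real (snd (fold (child_step R) cs (st, T))) \<le> real T + 6 * W * real (\<Sum>c\<leftarrow>cs. calls SC m c)"
  using assms(4-)
proof (induction cs arbitrary: st T)
  case (Cons c cs)
  define R' where "R' = filter (\<lambda>Nr. nn_score d st c Nr \<noteq> \<infinity>) R"
  obtain st1 T1 where tr: "nn_traverse c R' st = (st1, T1)" by fastforce
  have step: "child_step R c (st, T) = (st1, T + length R + T1)"
    using tr by (simp add: child_step_def R'_def)
  have post: "traverse_post SC c R' st"
    unfolding R'_def using Cons.prems(1) by (intro Cons.prems(4)) auto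
  then have st1: "consistent st1" "\<And>p. p \<notin> leaf_points c \<Longrightarrow> nn_dist st1 p = nn_dist st p"
    and T1: "real T1 + W \<le> 6 * W * real (calls SC (max_scale R') c)"
    using tr by (auto simp: traverse_post_def)
  have "max_scale R' \<le> m"
    by (rule order_trans[OF max_scale_mono assms(3)]) (auto simp: R'_def)
  then have "6 * W * real (calls SC (max_scale R') c) \<le> 6 * W * real (calls SC m c)"
    using calls_mono[OF assms(1), of "max_scale R'" m c] W_ge_1 by (intro mult_left_mono) auto
  then have time: "real (T + length R + T1) \<le> real T + 6 * W * real (calls SC m c)"
    using T1 assms(2) by simp
  have disj: "p \<notin> leaf_points c" if "c' \<in> set cs" "p \<in> leaf_points c'" for c' p
  proof -
    have "point c \<noteq> point c'" using Cons.prems(2) that(1) by force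
    then show ?thesis
      using qry.leaf_points_disjoint[of u c c'] Cons.prems(3) that by auto
  qed
  have IH: "consistent (fst (fold (child_step R) cs (st1, T + length R + T1)))
     \<and> (\<forall>p. (\<forall>c\<in>set cs. p \<notin> leaf_points c) \<longrightarrow>
          nn_dist (fst (fold (child_step R) cs (st1, T + length R + T1))) p = nn_dist st1 p)
     \<and> real (snd (fold (child_step R) cs (st1, T + length R + T1)))
        \<le> real (T + length R + T1) + 6 * W * real (\<Sum>c\<leftarrow>cs. calls SC m c)"
  proof (rule Cons.IH)
    fix c' st' assume c': "c' \<in> set cs" "consistent st'"
      and eq: "\<And>p. p \<in> leaf_points c' \<Longrightarrow> nn_dist st' p = nn_dist st1 p"
    have "nn_dist st' p = nn_dist st p" if "p \<in> leaf_points c'" for p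
      using eq[OF that] st1(2)[OF disj[OF c'(1) that]] by simp
    then show "traverse_post SC c' (filter (\<lambda>Nr. nn_score d st' c' Nr \<noteq> \<infinity>) R) st'"
      using c' by (intro Cons.prems(4)) auto
  qed (use st1(1) Cons.prems in auto)
  then show ?case using step st1(2) time by (simp add: algebra_simps)
qed simp

text \<open>Query recursion shrinks \<open>Nq\<close> (outer induction); reference recursion keeps
  \<open>Nq\<close> and shrinks the total size of \<open>R\<close> (inner induction).\<close>

lemma traverse_bound:
  assumes "finite SC" "invariant SC u t Nq R st"
  shows "traverse_post SC Nq R st"
  using assms(2)
proof (induction Nq arbitrary: u t R st rule: measure_induct_rule[of size])
  case outer: (less Nq)
  from outer.prems show ?case
  proof (induction R arbitrary: t st rule: measure_induct_rule[of "\<lambda>R. sum_list (map size R)"])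
    case (less R)
    note len = invariant_length_le[OF less.prems]
    show ?case
    proof (cases "node_scale Nq < max_scale R")
      case True
      define st1 where "st1 = fold (\<lambda>Nr. nn_base_case d (point Nq) (point Nr)) R st"
      define R' where "R' = filter (\<lambda>Nr. nn_score d st1 Nq Nr \<noteq> \<infinity>) (expand R)"
      obtain s where s: "s \<in> SC" "max_scale R = ereal (real_of_int s)"
        "invariant SC u (s - 1) Nq R' st1" "max_scale R' < max_scale R"
        using reference_step[OF less.prems True] unfolding st1_def R'_def by blast
      have "sum_list (map size R') < sum_list (map size R)"
        unfolding R'_def using sum_list_size_expand[OF True] sum_list_size_filter_le
        by (rule order.strict_trans1[rotated])
      then have post: "traverse_post SC Nq R' st1" using less.IH s(3) by blast
      have "real (calls SC (max_scale R') Nq) + 1 \<le> real (calls SC (max_scale R) Nq)"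
        using calls_less[OF assms(1) s(4)[unfolded s(2)] s(1) True[unfolded s(2)]] s(2) by simp
      \<comment> \<open>The recursion costs
        \<open>1 + 3 * length R + length (expand R) \<le> 5 * W\<close>, within the
        \<open>6 * W\<close> that the drop of \<open>calls\<close> releases.\<close>
      then have "6 * W * (real (calls SC (max_scale R') Nq) + 1) \<le> 6 * W * real (calls SC (max_scale R) Nq)"
        using W_ge_1 by (intro mult_left_mono) auto
      moreover have "nn_dist st1 p = nn_dist st p" if "p \<notin> leaf_points Nq" for p
      proof -
        have Nq: "qry.at_level u Nq" and st: "consistent st" and lev: "\<forall>N\<in>set R. ref.at_level t N"
          using less.prems by (auto simp: invariant_def)
        have "p \<noteq> point Nq" using that qry.point_in_leaf_points[OF Nq] by auto
        then show ?thesis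
          unfolding st1_def using lev ref.at_level_point_S by (intro fold_base_case_props(4)[OF st]) auto
      qed
      moreover have "real (length (expand R)) \<le> W" using len(2) s(2) by simp
      ultimately show ?thesis
        using post len(1) W_ge_1
        by (simp add: traverse_post_def traverse_reference[OF True] algebra_simps flip: st1_def R'_def)
    next
      case False
      have Nq: "qry.at_level u Nq" and st: "consistent st" using less.prems by (auto simp: invariant_def)
      have "consistent (fst (fold (child_step R) (children Nq) (st, 1 + length R)))
        \<and> (\<forall>p. (\<forall>c\<in>set (children Nq). p \<notin> leaf_points c) \<longrightarrow>
          nn_dist (fst (fold (child_step R) (children Nq) (st, 1 + length R))) p = nn_dist st p)
        \<and> real (snd (fold (child_step R) (children Nq) (st, 1 + length R)))
          \<le> real (1 + length R) + 6 * W * real (\<Sum>c\<leftarrow>children Nq. calls SC (node_scale Nq) c)"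
      proof (cases Nq)
        case (Leaf p)
        then show ?thesis using st by simp
      next
        case (Node pq sq ts)
        note levq = qry.at_level_Node[OF Nq[unfolded Node]]
        show ?thesis
        proof (rule fold_child_step[where u = "sq - 1"])
          fix c st' assume c: "c \<in> set (children Nq)" "consistent st'"
            and eq: "\<And>p. p \<in> leaf_points c \<Longrightarrow> nn_dist st' p = nn_dist st p"
          have "c \<in> set ts" using c Node by simp
          then have "invariant SC (sq - 1) t c (filter (\<lambda>Nr. nn_score d st' c Nr \<noteq> \<infinity>) R) st'"
            using query_step[OF less.prems Node _ c(2) eq] by blast
          moreover have "size c < size Nq" using c(1) by (rule size_child_less)
          ultimately show "traverse_post SC c (filter (\<lambda>Nr. nn_score d st' c Nr \<noteq> \<infinity>) R) st'"
            using outer.IH by blast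
        qed (use assms(1) len(1) False st levq Node in \<open>auto simp: not_less\<close>)
      qed
      moreover have "leaf_points c \<subseteq> leaf_points Nq" if "c \<in> set (children Nq)" for c
        using that by (cases Nq) auto
      moreover have "real (1 + length R) + W \<le> 6 * W * 1" using len(1) W_ge_1 by simp
      moreover have "6 * W * 1 + 6 * W * real (\<Sum>c\<leftarrow>children Nq. calls SC (node_scale Nq) c)
          \<le> 6 * W * real (calls SC (max_scale R) Nq)"
      proof -
        have "6 * W * (1 + real (\<Sum>c\<leftarrow>children Nq. calls SC (node_scale Nq) c))
            \<le> 6 * W * real (calls SC (max_scale R) Nq)"
          using W_ge_1 by (intro mult_left_mono) (auto simp: calls_eq[of SC _ Nq])
        then show ?thesis by (simp add: distrib_left)
      qed
      ultimately show ?thesis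
        unfolding traverse_post_def traverse_query[OF False] by (smt (verit) subsetD)
    qed
  qed
qed

text \<open>The root of the reference tree contains every point of \<open>Sr\<close>, so the initial
  call satisfies \<open>covered\<close>.\<close>

lemma nn_time_le:
  assumes Tr: "ref.at_level tr Tr" "Cr tr = {point Tr}" and Tq: "qry.at_level tq Tq"
  shows "real (nn_time d Tq Tr) \<le> 6 * W * real (calls (nonleaf_scales Tr) (node_scale Tr) Tq)"
proof -
  have "leaf_points Tr = Sr" using Tr by (rule ref.leaf_points_root)
  then have "covered nn_init [Tr] p" for p
    using nn_attained[of p] by (simp add: covered_def)
  moreover have "consistent nn_init" by (simp add: consistent_def nn_init_def)
  ultimately have "invariant (nonleaf_scales Tr) tq tr Tq [Tr] nn_init"
    using Tr(1) Tq by (auto simp: invariant_def nn_init_def)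
  then have "traverse_post (nonleaf_scales Tr) Tq [Tr] nn_init"
    by (intro traverse_bound ref.finite_nonleaf_scales)
  moreover have "max_scale [Tr] = node_scale Tr" by (simp add: max_scale_def max_def)
  ultimately show ?thesis using W_ge_1 by (simp add: traverse_post_def nn_time_def)
qed

end

section \<open>Counting the recursive calls\<close>

lemma int_sum_list_map: "int (\<Sum>x\<leftarrow>xs. f x) = (\<Sum>x\<leftarrow>xs. int (f x))"
  by (induction xs) auto

context cover_tree_levels
begin

text \<open>The constant 3 comes from leaves with \<open>smin < sp\<close>:
  \<open>(sp - lo + 1) + 1\<close> is \<open>(sp - smin - 1) + (smin - lo) + 3\<close>.
  \<open>X\<close> bounds the excess per leaf by either count.\<close>

lemma calls_le_imbalance:
  fixes SC :: "int set" and X :: nat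
  assumes "finite SC" "\<And>\<sigma>. \<sigma> \<in> SC \<Longrightarrow> lo \<le> \<sigma>"
    and X: "card SC \<le> X \<or> nat (smin - lo) \<le> X"
  shows "at_level (sp - 1) N \<Longrightarrow> \<forall>\<sigma>\<in>nonleaf_scales N. smin \<le> \<sigma> \<Longrightarrow> smin \<le> sp \<Longrightarrow>
    int (calls SC (ereal (real_of_int sp)) N)
      \<le> sum_imbalance smin (Some sp) N + 3 * int (num_nodes N) + int (num_leaves N * X)"
proof (induction N arbitrary: sp)
  case (Leaf p)
  have "card {\<sigma>\<in>SC. \<sigma> \<le> sp} \<le> card SC" using assms(1) by (intro card_mono) auto
  moreover have "card {\<sigma>\<in>SC. \<sigma> \<le> sp} \<le> card {lo..sp}" using assms(2) by (intro card_mono) auto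
  ultimately show ?case using X Leaf.prems(3) by auto
next
  case (Node p s ts)
  note lev = at_level_Node[OF Node.prems(1)]
  have "card {\<sigma>\<in>SC. s < \<sigma> \<and> \<sigma> \<le> sp} \<le> card {s<..sp}" by (intro card_mono) auto
  then have "int (card {\<sigma>\<in>SC. s < \<sigma> \<and> \<sigma> \<le> sp}) \<le> sp - s" using lev(1) by simp
  moreover have "int (calls SC (ereal (real_of_int s)) c)
      \<le> sum_imbalance smin (Some s) c + 3 * int (num_nodes c) + int (num_leaves c * X)"
    if "c \<in> set ts" for c
    using that Node.prems(2) lev(6) by (intro Node.IH) auto
  then have "(\<Sum>c\<leftarrow>ts. int (calls SC (ereal (real_of_int s)) c))
      \<le> (\<Sum>c\<leftarrow>ts. sum_imbalance smin (Some s) c + 3 * int (num_nodes c) + int (num_leaves c * X))"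
    by (intro sum_list_mono) auto
  then have "int (\<Sum>c\<leftarrow>ts. calls SC (ereal (real_of_int s)) c)
      \<le> (\<Sum>c\<leftarrow>ts. sum_imbalance smin (Some s) c) + 3 * int (\<Sum>c\<leftarrow>ts. num_nodes c)
        + int ((\<Sum>c\<leftarrow>ts. num_leaves c) * X)"
    by (simp add: sum_list_addf sum_list_const_mult sum_list_mult_const comp_def int_sum_list_map)
  ultimately show ?case by simp
qed

lemma sum_imbalance_nonneg:
  "at_level (sp - 1) N \<Longrightarrow> 0 \<le> sum_imbalance smin (Some sp) N"
proof (induction N arbitrary: sp)
  case (Node p s ts)
  note lev = at_level_Node[OF Node.prems(1)]
  have "0 \<le> (\<Sum>c\<leftarrow>ts. sum_imbalance smin (Some s) c)"
    using Node.IH lev(6) by (intro sum_list_nonneg) auto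
  then show ?case using lev(1) by simp
qed simp

lemma imbalance_nonneg: "at_level t N \<Longrightarrow> 0 \<le> imbalance N"
proof (cases N)
  case (Node p s ts)
  assume "at_level t N"
  note lev = at_level_Node[OF this[unfolded Node]]
  show ?thesis
    using Node lev(6) sum_imbalance_nonneg by (auto simp: imbalance_def intro!: sum_list_nonneg)
qed (simp add: imbalance_def)

section \<open>The smallest distance and the smallest scale\<close>

lemma min_nonzero_dist_le: "x \<in> S \<Longrightarrow> y \<in> S \<Longrightarrow> x \<noteq> y \<Longrightarrow> min_nonzero_dist d S \<le> d x y"
  and min_nonzero_dist_attained:
    "x \<in> S \<Longrightarrow> y \<in> S \<Longrightarrow> x \<noteq> y \<Longrightarrow> \<exists>x\<in>S. \<exists>y\<in>S. x \<noteq> y \<and> d x y = min_nonzero_dist d S"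
proof -
  let ?D = "{d x y | x y. x \<in> S \<and> y \<in> S \<and> d x y \<noteq> 0}"
  have "?D \<subseteq> (\<lambda>(x, y). d x y) ` (S \<times> S)" by auto
  then have fin: "finite ?D" using finite_S finite_subset by blast
  assume xy: "x \<in> S" "y \<in> S" "x \<noteq> y"
  then have "d x y \<noteq> 0" using S_subset by (auto simp: subset_iff)
  then have "d x y \<in> ?D" using xy by blast
  then show "min_nonzero_dist d S \<le> d x y"
    unfolding min_nonzero_dist_def using fin by (intro Min_le)
  have "min_nonzero_dist d S \<in> ?D"
    unfolding min_nonzero_dist_def using fin \<open>d x y \<in> ?D\<close> by (intro Min_in) auto
  then obtain x' y' where "x' \<in> S" "y' \<in> S" "d x' y' \<noteq> 0" "d x' y' = min_nonzero_dist d S"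
    by auto
  moreover from this have "x' \<noteq> y'" using S_subset by auto
  ultimately show "\<exists>x\<in>S. \<exists>y\<in>S. x \<noteq> y \<and> d x y = min_nonzero_dist d S"
    by blast
qed

lemma min_nonzero_dist_less:
  assumes "at_level t N" "\<sigma> \<in> nonleaf_scales N"
  shows "0 < min_nonzero_dist d S" "min_nonzero_dist d S < 2 powi \<sigma>"
proof -
  obtain x y where xy: "x \<in> S" "y \<in> S" "x \<noteq> y" "d x y < 2 powi \<sigma>"
    using close_pair_of_scale[OF assms] by blast
  then show "min_nonzero_dist d S < 2 powi \<sigma>" using min_nonzero_dist_le by fastforce
  obtain x' y' where "x' \<in> S" "y' \<in> S" "x' \<noteq> y'" "d x' y' = min_nonzero_dist d S"
    using min_nonzero_dist_attained xy by blast
  then show "0 < min_nonzero_dist d S" using S_subset by (metis mdist_pos_less subsetD)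
qed

text \<open>All of \<open>S\<close> lies in the level below the smallest non-leaf scale and is
  separated there. With \<open>min_nonzero_dist_less\<close> this makes that scale the ceiling of
  the logarithm of the smallest distance.\<close>

lemma min_nonzero_dist_greater:
  assumes root: "at_level t N" "C t = {point N}" and "nonleaf_scales N \<noteq> {}"
  shows "2 powi (Min (nonleaf_scales N) - 1) < min_nonzero_dist d S"
proof -
  let ?m = "Min (nonleaf_scales N)"
  have m: "?m \<in> nonleaf_scales N" "\<forall>\<sigma>\<in>nonleaf_scales N. ?m \<le> \<sigma>"
    using Min_in[OF finite_nonleaf_scales assms(3)] Min_le[OF finite_nonleaf_scales] by auto
  have "?m - 1 \<le> t" using nonleaf_scales_le[OF root(1) m(1)] by simp
  then have "S \<subseteq> C (?m - 1)"
    using leaf_points_in_bottom_level[OF root(1) m(2)] leaf_points_root[OF root] by simp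
  moreover obtain x y where "x \<in> S" "y \<in> S" "x \<noteq> y" "d x y = min_nonzero_dist d S"
    using close_pair_of_scale[OF root(1) m(1)] min_nonzero_dist_attained by blast
  ultimately show ?thesis using separated[of x "?m - 1" y] by auto
qed

end

lemma powi_less_log:
  assumes "0 < x"
  shows "2 powi m < x \<longleftrightarrow> real_of_int m < log 2 x" "x < 2 powi m \<longleftrightarrow> log 2 x < real_of_int m"
proof -
  have "2 powi m = 2 powr real_of_int m" by (simp add: powr_real_of_int')
  then show "2 powi m < x \<longleftrightarrow> real_of_int m < log 2 x" "x < 2 powi m \<longleftrightarrow> log 2 x < real_of_int m"
    using assms by (simp_all add: less_log_iff log_less_iff)
qed

context nn_search
begin

text \<open>The root has imbalance 0, so its own calls are paid by \<open>card Sr\<close>, which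
  exceeds the number of reference scales. Of the 7, six come from three per node with at most
  \<open>2 * card Sq\<close> nodes, one from rounding in \<open>X_le\<close>.\<close>

lemma calls_root_le:
  assumes Tr: "ref.at_level tr Tr" and Tq: "qry.at_level tq Tq" "Cq tq = {point Tq}"
  shows "real (calls (nonleaf_scales Tr) m Tq)
    \<le> real (card Sr) + real_of_int (imbalance Tq) + 7 * real (card Sq)
       + real (card Sq) * max (min (log 2 (min_nonzero_dist d Sq / min_nonzero_dist d Sr)) (real (card Sr))) 0"
proof -
  define SC where "SC = nonleaf_scales Tr"
  define L where "L = log 2 (min_nonzero_dist d Sq / min_nonzero_dist d Sr)"
  have fin: "finite SC" using ref.finite_nonleaf_scales by (simp add: SC_def)
  have "leaf_points Tr \<subseteq> Sr" using ref.leaf_points_subset[OF Tr] .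
  then have "num_leaves Tr \<le> card Sr"
    using ref.num_leaves_eq_card[OF Tr] ref.finite_S by (simp add: card_mono)
  then have card_SC: "card SC + 1 \<le> card Sr"
    using ref.card_nonleaf_scales[OF Tr] by (simp add: SC_def)
  have leaves: "num_leaves Tq = card Sq"
    using qry.num_leaves_eq_card[OF Tq(1)] qry.leaf_points_root[OF Tq] by simp
  have nodes: "num_nodes Tq \<le> 2 * card Sq"
    using qry.num_nodes_le[OF Tq(1)] leaves by simp
  have sub: "card {\<sigma>\<in>SC. P \<sigma>} \<le> card SC" for P using fin by (intro card_mono) auto
  show ?thesis
  proof (cases Tq)
    case (Leaf p)
    then have "calls SC m Tq \<le> card Sr"
      using sub[of "\<lambda>\<sigma>. ereal (real_of_int \<sigma>) \<le> m"] card_SC by simp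
    then have "real (calls SC m Tq) \<le> real (card Sr)" by simp
    moreover have "0 \<le> real (card Sq) * max (min L (real (card Sr))) 0" by simp
    moreover have "real_of_int (imbalance Tq) = 0" using Leaf by (simp add: imbalance_def)
    ultimately have "real (calls SC m Tq) \<le> real (card Sr) + real_of_int (imbalance Tq)
        + 7 * real (card Sq) + real (card Sq) * max (min L (real (card Sr))) 0"
      by linarith
    then show ?thesis by (simp only: SC_def L_def)
  next
    case (Node p s ts)
    define smin where "smin = Min (nonleaf_scales Tq)"
    define lo where "lo = Min SC"
    define X where "X = min (card SC) (nat (smin - lo))"
    have smin: "\<forall>\<sigma>\<in>nonleaf_scales Tq. smin \<le> \<sigma>" "smin \<le> s" "smin \<in> nonleaf_scales Tq"
    proof -
      have fin: "finite (nonleaf_scales Tq)" and s: "s \<in> nonleaf_scales Tq"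
        and ne: "nonleaf_scales Tq \<noteq> {}"
        using qry.finite_nonleaf_scales[of Tq] by (auto simp: Node)
      then show "\<forall>\<sigma>\<in>nonleaf_scales Tq. smin \<le> \<sigma>" "smin \<le> s" "smin \<in> nonleaf_scales Tq"
        using Min_in[OF fin ne] Min_le[OF fin] unfolding smin_def by auto
    qed
    \<comment> \<open>\<open>smin - 1\<close> is below the logarithm of the smallest query distance
      and \<open>lo\<close> above that of the smallest reference distance, so
      \<open>smin - lo < L + 1\<close>.\<close>
    have X_le: "real X \<le> max (min L (real (card Sr))) 0 + 1"
    proof (cases "SC = {}")
      case True
      then show ?thesis by (simp add: X_def)
    next
      case False
      then have "lo \<in> SC" using fin by (simp add: lo_def)
      then have dr: "0 < min_nonzero_dist d Sr" "min_nonzero_dist d Sr < 2 powi lo"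
        using ref.min_nonzero_dist_less[OF Tr] by (auto simp: SC_def)
      have dq: "0 < min_nonzero_dist d Sq" "2 powi (smin - 1) < min_nonzero_dist d Sq"
        using qry.min_nonzero_dist_less(1)[OF Tq(1) smin(3)] qry.min_nonzero_dist_greater[OF Tq] smin(3)
        by (auto simp: smin_def)
      have "L = log 2 (min_nonzero_dist d Sq) - log 2 (min_nonzero_dist d Sr)"
        using dr dq by (simp add: L_def log_divide)
      then have "real_of_int (smin - lo) < L + 1"
        using dr dq by (simp add: powi_less_log)
      moreover have "real X \<le> real (card SC)" "real X \<le> max 0 (real_of_int (smin - lo))"
        by (simp_all add: X_def)
      ultimately show ?thesis using card_SC by linarith
    qed
    then have X: "real (card Sq) * real X
        \<le> real (card Sq) * max (min L (real (card Sr))) 0 + real (card Sq)"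
      using mult_left_mono[OF X_le, of "real (card Sq)"] by (simp add: distrib_left)
    note lev = qry.at_level_Node[OF Tq(1)[unfolded Node]]
    have "int (calls SC (ereal (real_of_int s)) c)
        \<le> sum_imbalance smin (Some s) c + 3 * int (num_nodes c) + int (num_leaves c * X)"
      if "c \<in> set ts" for c
    proof (rule qry.calls_le_imbalance[OF fin, of lo])
      show "lo \<le> \<sigma>" if "\<sigma> \<in> SC" for \<sigma> using that fin by (simp add: lo_def)
    qed (use that lev(6) smin Node in \<open>auto simp: X_def\<close>)
    then have "(\<Sum>c\<leftarrow>ts. int (calls SC (ereal (real_of_int s)) c))
        \<le> (\<Sum>c\<leftarrow>ts. sum_imbalance smin (Some s) c + 3 * int (num_nodes c) + int (num_leaves c * X))"
      by (intro sum_list_mono) auto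
    then have "int (\<Sum>c\<leftarrow>ts. calls SC (ereal (real_of_int s)) c)
        \<le> imbalance Tq + 3 * int (num_nodes Tq) + int (num_leaves Tq * X)"
      by (simp add: imbalance_def Node smin_def sum_list_addf sum_list_const_mult sum_list_mult_const
          comp_def int_sum_list_map)
    moreover have "calls SC m Tq \<le> card Sr + (\<Sum>c\<leftarrow>ts. calls SC (ereal (real_of_int s)) c)"
      using sub[of "\<lambda>\<sigma>. s < \<sigma> \<and> ereal (real_of_int \<sigma>) \<le> m"] card_SC Node by simp
    ultimately have "int (calls SC m Tq) \<le> int (card Sr) + imbalance Tq + 6 * int (card Sq) + int (card Sq * X)"
      using nodes leaves by simp
    then have "real_of_int (int (calls SC m Tq))
        \<le> real_of_int (int (card Sr) + imbalance Tq + 6 * int (card Sq) + int (card Sq * X))"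
      by (rule of_int_le_iff[THEN iffD2])
    then show ?thesis using X by (simp add: SC_def L_def)
  qed
qed

text \<open>The second factor is the excess charged to each query leaf.\<close>

lemma theta_eq:
  "theta d Sq Sr = real (card Sr) *
     max (min (log 2 (min_nonzero_dist d Sq / min_nonzero_dist d Sr)) (real (card Sr))) 0"
  by (simp add: theta_def max_mult_distrib_left min_mult_distrib_left power2_eq_square)

lemma nn_time_bound:
  assumes Tr: "ref.at_level tr Tr" "Cr tr = {point Tr}"
    and Tq: "qry.at_level tq Tq" "Cq tq = {point Tq}"
    and K: "real (card Sq) \<le> K * real (card Sr)"
  shows "real (nn_time d Tq Tr) \<le> 6 * (1 + 7 * \<bar>K\<bar>) *
    (c_ref ^ 4 * c_max ^ 5 * (real (card Sr) + real_of_int (imbalance Tq) + theta d Sq Sr))"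
proof -
  define N where "N = real (card Sr)"
  define I where "I = real_of_int (imbalance Tq)"
  define Y where "Y = max (min (log 2 (min_nonzero_dist d Sq / min_nonzero_dist d Sr)) N) 0"
  have Y: "0 \<le> Y" "theta d Sq Sr = N * Y" by (simp_all add: Y_def N_def theta_eq)
  have I: "0 \<le> I" using qry.imbalance_nonneg[OF Tq(1)] by (simp add: I_def)
  have N: "0 \<le> N" by (simp add: N_def)
  have q: "real (card Sq) \<le> \<bar>K\<bar> * N"
    using K mult_right_mono[of K "\<bar>K\<bar>" N, OF abs_ge_self N] by (simp add: N_def)
  have "real (calls (nonleaf_scales Tr) (node_scale Tr) Tq)
      \<le> N + I + 7 * real (card Sq) + real (card Sq) * Y"
    using calls_root_le[OF Tr(1) Tq] by (simp add: N_def I_def Y_def)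
  also have "\<dots> \<le> N + I + 7 * (\<bar>K\<bar> * N) + (\<bar>K\<bar> * N) * Y"
    using q Y(1) by (intro add_mono mult_left_mono mult_right_mono) auto
  also have "\<dots> \<le> (1 + 7 * \<bar>K\<bar>) * (N + I + N * Y)"
    using Y(1) I N by (simp add: algebra_simps)
  finally have "6 * W * real (calls (nonleaf_scales Tr) (node_scale Tr) Tq)
      \<le> 6 * W * ((1 + 7 * \<bar>K\<bar>) * (N + I + N * Y))"
    using W_ge_1 by (intro mult_left_mono) auto
  then have "real (nn_time d Tq Tr) \<le> 6 * W * ((1 + 7 * \<bar>K\<bar>) * (N + I + N * Y))"
    using nn_time_le[OF Tr Tq(1)] by linarith
  also have "\<dots> = 6 * (1 + 7 * \<bar>K\<bar>) * (W * (N + I + N * Y))" by (simp only: mult_ac)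
  finally show ?thesis by (simp only: N_def I_def Y(2) W_def)
qed

end

theorem theorem2:
  fixes K :: real
  shows "\<exists>A>0. \<forall>(M :: 'a set) d Sr Sq Tr Tq.
           Metric_space M d \<and>
           finite Sr \<and> Sr \<subseteq> M \<and> finite Sq \<and> Sq \<subseteq> M \<and>
           real (card Sq) \<le> K * real (card Sr) \<and>
           cover_tree d Sr Tr \<and> cover_tree d Sq Tq \<longrightarrow>
           real (nn_time d Tq Tr)
             \<le> A * ((expansion_constant d Sr) ^ 4 * (c_qr d Sq Sr) ^ 5
                     * (real (card Sr) + real_of_int (imbalance Tq) + theta d Sq Sr))"
\<comment> \<open>The witness depends on \<open>K\<close> only; the absolute value keeps it positive
  for every real \<open>K\<close>.\<close>
proof (intro exI[of _ "6 * (1 + 7 * \<bar>K\<bar>)"] conjI allI impI)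
  show "0 < 6 * (1 + 7 * \<bar>K\<bar>)" by simp
next
  fix M :: "'a set" and d Sr Sq Tr Tq
  assume H: "Metric_space M d \<and>
           finite Sr \<and> Sr \<subseteq> M \<and> finite Sq \<and> Sq \<subseteq> M \<and>
           real (card Sq) \<le> K * real (card Sr) \<and>
           cover_tree d Sr Tr \<and> cover_tree d Sq Tq"
  then obtain Cr parr rr tr where r: "implicit_cover_tree d Sr Cr parr rr" "Cr tr = {rr}"
    "explicit Cr parr tr rr Tr"
    by (auto simp: cover_tree_def)
  from H obtain Cq parq rq tq where q: "implicit_cover_tree d Sq Cq parq rq" "Cq tq = {rq}"
    "explicit Cq parq tq rq Tq"
    by (auto simp: cover_tree_def)
  interpret Metric_space M d using H by blast
  interpret nn_search M d Sr Cr parr rr Sq Cq parq rq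
    by unfold_locales (use H r q in auto)
  have "point Tr = rr" "point Tq = rq"
    using ref.explicit_point[OF r(3)] qry.explicit_point[OF q(3)] by auto
  then show "real (nn_time d Tq Tr) \<le> 6 * (1 + 7 * \<bar>K\<bar>) *
      ((expansion_constant d Sr) ^ 4 * (c_qr d Sq Sr) ^ 5
         * (real (card Sr) + real_of_int (imbalance Tq) + theta d Sq Sr))"
    using r q H by (intro nn_time_bound[of tr _ tq]) (auto simp: ref.at_level_def qry.at_level_def)
qed

end
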